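(* Let $p,q\ge 0$ be integers with $p+1\le q$, let $a_1,\dots,a_p>0$ and $b_1,\dots,b_q>0$, and suppose that $g(s)={}_pF_q(a_1,\dots,a_p;b_1,\dots,b_q;-s^2)$, $s\in\mathbb{R}$, is the characteristic function of a real random variable with an even (symmetric) probability density. For a constant $C$ define, for $s>0$, $$h(s)=\frac{C}{s}\exp\left(-\int_s^{\infty}\frac{g(\xi)}{\xi}\,d\xi\right).$$ Then the normalization $\lim_{s\to 0^+}h(s)=1$ holds exactly when $$C=\exp\left(\frac12\left(-\gamma-\sum_{i=1}^p\psi(a_i)+\sum_{j=1}^q\psi(b_j)\right)\right).$$
   Context: The generalized hypergeometric function is ${}_pF_q(a_1,\dots,a_p;b_1,\dots,b_q;z)=\sum_{n=0}^\infty \frac{(a_1)_n\cdots(a_p)_n}{(b_1)_n\cdots(b_q)_n}\frac{z^n}{n!}$, where $(a)_n=\Gamma(a+n)/\Gamma(a)$ is the Pochhammer symbol; an empty list of parameters contributes an empty product (equal to $1$) and an empty sum (equal to $0$). $\psi=\Gamma'/\Gamma$ is the digamma function and $\gamma$ is Euler's constant. Integrals over $[s,\infty)$ are improper integrals $\lim_{R\to\infty}\int_s^R$. The function $h$ represents the Fourier transform (characteristic function) of the stationary density of the shot noise recursion $W_{n+1}=U_{n+1}(W_n+\Lambda_{n+1})$ with independent uniform $U_i$ on $[0,1]$ and independent amplitudes $\Lambda_i$ with characteristic function $g$. *)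

theory Defs
  imports "HOL-Probability.Probability"
begin

definition hypergeo :: "real list \<Rightarrow> real list \<Rightarrow> real \<Rightarrow> real" where
  "hypergeo a b z = eval_fps (fps_hypergeo a b 1) z"

lemma foldl_times_eq_prod_list:
  fixes f :: "'a \<Rightarrow> 'b::comm_monoid_mult"
  shows "foldl (\<lambda>r x. r * f x) c xs = c * (\<Prod>x\<leftarrow>xs. f x)"
  by (induction xs arbitrary: c) (simp_all add: mult.assoc)

lemma hypergeo_series:
  "hypergeo a b z =
     (\<Sum>n. (\<Prod>x\<leftarrow>a. pochhammer x n) / (\<Prod>y\<leftarrow>b. pochhammer y n) * z ^ n / fact n)"
  by (simp add: hypergeo_def eval_fps_def foldl_times_eq_prod_list)

(* Convergence at infinity may be merely conditional, so this is not the Lebesgue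
   integral over {s..}; the value is meaningful only if the limit exists. *)
definition improper_integral :: "real \<Rightarrow> (real \<Rightarrow> real) \<Rightarrow> real" where
  "improper_integral s f = Lim at_top (\<lambda>R. integral {s..R} f)"

definition shot_noise_cf :: "real \<Rightarrow> (real \<Rightarrow> real) \<Rightarrow> real \<Rightarrow> real" where
  "shot_noise_cf C g s = C / s * exp (- improper_integral s (\<lambda>\<xi>. g \<xi> / \<xi>))"

end

(* With Y = X^2/4, the power series of g gives E Y^n = prod_x (x)_n / prod_y (y)_n, where x runs over
   1/2, a_1, ..., a_p and y over b_1, ..., b_q.  Growth of these moments forces q = p + 1 and
   0 < Y <= 1; the moments then determine E ln Y through -ln Y = sum_k (1 - Y)^k / k, and comparing
   with products of Beta variables gives E ln Y = sum_x psi(x) - sum_y psi(y).  In particular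
   ln |X| is integrable, so by Fubini the tail integral of g(xi)/xi converges and equals
   -E Ci(s |X|), where Ci(y) = gamma + ln y + o(1) as y -> 0. *)

theory Submission
  imports Defs
begin

section \<open>The cosine integral and characteristic functions\<close>

text \<open>The data on X are the Taylor coefficients of g, hence moments of integer order. E |X|^z
  for small z > 0, whose derivative at z = 0 would give E ln |X|, is not directly available. This is
  why E ln Y is carried over from an explicit product of Beta laws, whose moments of real order are
  known. Such a product needs every numerator parameter to lie below its partner in the denominator,
  which the given parameters need not satisfy. Multiplying by further independent Beta factors makes
  every pairing possible, and their log-means cancel in the end. The integral of |cos (xi X)| / xi
  over [s, oo) diverges for X nonzero, so Fubini is applied on bounded intervals only. The limit is
  taken under the expectation by dominated convergence, with |ln |X|| plus a constant as majorant.
  Euler's constant enters twice. Ci gives the exponent -gamma - E ln |X| of C. The parameter 1/2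
  gives psi(1/2) = -gamma - 2 ln 2, where 2 ln 2 cancels against the 4 in Y; this puts -gamma/2 into
  E ln |X|, and so -gamma/2 remains in the exponent.\<close>

definition cosc :: "real \<Rightarrow> real" where
  "cosc u = (if u = 0 then 0 else (cos u - 1) / u)"

text \<open>The cosine integral is \<open>Ci y = euler_mascheroni + ln y + cin y\<close>.\<close>

definition cin :: "real \<Rightarrow> real" where
  "cin y = (LBINT u=0..y. cosc u)"

text \<open>At 0 the quotient is the difference quotient of cos, whose limit is 0, the value chosen
  in \<open>cosc\<close>.\<close>

lemma isCont_cosc: "isCont cosc x"
proof (cases "x = 0")
  case True
  have "((\<lambda>u::real. (cos u - 1) / u) \<longlongrightarrow> 0) (at 0)"
    using DERIV_cos [of 0] by (auto simp: has_field_derivative_def field_has_derivative_at)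
  then have "(cosc \<longlongrightarrow> 0) (at 0)"
    by (rule Lim_transform_eventually) (auto simp: cosc_def eventually_at_filter)
  then show ?thesis
    using True by (simp add: isCont_def cosc_def)
next
  case False
  show ?thesis
    by (rule continuous_transform_within [where \<delta> = "\<bar>x\<bar>" and f = "\<lambda>u. (cos u - 1) / u"])
       (use False in \<open>auto simp: dist_real_def cosc_def intro!: continuous_intros\<close>)
qed

lemma DERIV_cin: "(cin has_real_derivative cosc x) (at x)"
proof -
  \<comment> \<open>The interval has to contain the base point 0 of the integral and have x in its
    interior, so that the derivative within it is the full one.\<close>
  have "(at x within {min 0 (x - 1)..max 0 (x + 1)}) = at x"
    by (intro at_within_interior) auto
  moreover have "min 0 (x - 1) \<le> x" "x \<le> max 0 (x + 1)"
    by auto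
  ultimately show ?thesis
    using interval_integral_FTC2[of "min 0 (x - 1)" 0 "max 0 (x + 1)" cosc x]
    by (auto simp: continuous_at_imp_continuous_on isCont_cosc cin_def[abs_def] zero_ereal_def
                   has_real_derivative_iff_has_vector_derivative
             split del: if_split)
qed

lemma isCont_cin: "isCont cin x"
  using DERIV_cin by (rule DERIV_isCont)

lemma borel_measurable_cin[measurable]: "cin \<in> borel_measurable borel"
  by (auto intro: isCont_cin continuous_at_imp_continuous_on borel_measurable_continuous_onI)

lemma cin_0 [simp]: "cin 0 = 0"
  by (simp add: cin_def flip: zero_ereal_def)

lemma DERIV_ln_plus_cin:
  assumes "y > 0"
  shows "((\<lambda>y. ln y + cin y) has_real_derivative cos y / y) (at y)"
  using assms by (auto intro!: derivative_eq_intros DERIV_cin simp: cosc_def field_simps)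

text \<open>Subtracting sin y / y amounts to one integration by parts of cos u / u. The difference D
  has derivative sin y / y^2, bounded by 1 / y^2, so D - 1/y increases, D + 1/y decreases, and both
  squeeze the same l. Of the bound 2 / y, one half comes from this squeeze and the other from sin y
  / y.\<close>

lemma ln_plus_cin_converges:
  "\<exists>l. \<forall>y>0. \<bar>ln y + cin y - l\<bar> \<le> 2 / y"
proof -
  define D where "D y = ln y + cin y - sin y / y" for y
  have der: "(D has_real_derivative sin y / y\<^sup>2) (at y)" if "y > 0" for y
  proof -
    have "((\<lambda>y. sin y / y) has_real_derivative cos y / y - sin y / y\<^sup>2) (at y)"
      using that by (auto intro!: derivative_eq_intros simp: field_simps power2_eq_square)
    from DERIV_diff [OF DERIV_ln_plus_cin [OF that] this] show ?thesis
      by (simp add: D_def [abs_def])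
  qed
  have dec: "D z + 1 / z \<le> D y + 1 / y" and inc: "D y - 1 / y \<le> D z - 1 / z" if "0 < y" "y \<le> z" for y z
  proof -
    show "D z + 1 / z \<le> D y + 1 / y"
    proof (rule DERIV_nonpos_imp_nonincreasing [OF that(2)])
      fix x assume "y \<le> x" "x \<le> z"
      then have "((\<lambda>x. D x + 1 / x) has_real_derivative (sin x - 1) / x\<^sup>2) (at x)"
        using that by (auto intro!: derivative_eq_intros der simp: field_simps power2_eq_square)
      then show "\<exists>d. ((\<lambda>x. D x + 1 / x) has_real_derivative d) (at x) \<and> d \<le> 0"
        by (intro exI conjI) (auto simp: divide_nonpos_nonneg)
    qed
    show "D y - 1 / y \<le> D z - 1 / z"
    proof (rule DERIV_nonneg_imp_nondecreasing [OF that(2)])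
      fix x assume "y \<le> x" "x \<le> z"
      then have "((\<lambda>x. D x - 1 / x) has_real_derivative (sin x + 1) / x\<^sup>2) (at x)"
        using that by (auto intro!: derivative_eq_intros der simp: field_simps power2_eq_square)
      moreover have "sin x + 1 \<ge> 0"
        using sin_ge_minus_one [of x] by linarith
      ultimately show "\<exists>d. ((\<lambda>x. D x - 1 / x) has_real_derivative d) (at x) \<and> d \<ge> 0"
        by (intro exI [of _ "(sin x + 1) / x\<^sup>2"]) simp
    qed
  qed
  \<comment> \<open>Any number between the increasing and the decreasing function would do;
    \<open>cross\<close> shows that the supremum of the former is one.\<close>
  define l where "l = (SUP y\<in>{0<..}. D y - 1 / y)"
  have cross: "D y - 1 / y \<le> D z + 1 / z" if "y > 0" "z > 0" for y z
  proof (cases "y \<le> z")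
    case True
    have "1 / z \<ge> 0" "1 / z > - (1 / z)" using that by auto
    then show ?thesis using inc [OF \<open>y > 0\<close> True] by linarith
  next
    case False
    have "1 / y > 0" using that by auto
    then show ?thesis using dec [OF \<open>z > 0\<close>, of y] False by linarith
  qed
  have bdd: "bdd_above ((\<lambda>y. D y - 1 / y) ` {0<..})"
    by (rule bdd_aboveI2 [where M = "D 1 + 1 / 1"]) (use cross [of _ 1] in auto)
  have "\<bar>ln y + cin y - l\<bar> \<le> 2 / y" if "y > 0" for y
  proof -
    have "D y - 1 / y \<le> l"
      unfolding l_def by (rule cSUP_upper [OF _ bdd]) (use that in auto)
    moreover have "l \<le> D y + 1 / y"
      unfolding l_def by (rule cSUP_least) (use that cross in auto)
    moreover have "\<bar>sin y / y\<bar> \<le> 1 / y"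
      using that by (simp add: divide_right_mono)
    ultimately have "\<bar>ln y + cin y - l\<bar> \<le> 1 / y + 1 / y"
      unfolding D_def by linarith
    then show ?thesis by simp
  qed
  then show ?thesis by blast
qed

text \<open>Compactness handles [0, 1]; beyond 1 the asymptotics leave only logarithmic growth. The
  bound serves to dominate \<open>cin (s * \<bar>X \<omega>\<bar>)\<close> by a constant plus |ln
  |X||.\<close>

lemma cin_bound:
  assumes l: "\<And>y. y > 0 \<Longrightarrow> \<bar>ln y + cin y - l\<bar> \<le> 2 / y"
  shows "\<exists>B\<ge>0. \<forall>y>0. \<bar>cin y\<bar> \<le> B + (if y \<ge> 1 then ln y else 0)"
proof -
  have "\<exists>M. \<forall>x. 0 \<le> x \<and> x \<le> (1::real) \<longrightarrow> \<bar>cin x\<bar> \<le> M"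
    by (rule isCont_bounded) (auto intro!: isCont_cin continuous_intros)
  then obtain M where M: "\<And>x. 0 \<le> x \<Longrightarrow> x \<le> 1 \<Longrightarrow> \<bar>cin x\<bar> \<le> M" by auto
  have "\<bar>cin y\<bar> \<le> max M (2 + \<bar>l\<bar>) + (if y \<ge> 1 then ln y else 0)" if "y > 0" for y
  proof (cases "y \<ge> 1")
    case True
    then have "2 / y \<le> 2" "ln y \<ge> 0" by (auto simp: field_simps)
    moreover note l [OF that]
    ultimately have "\<bar>cin y\<bar> \<le> (2 + \<bar>l\<bar>) + ln y" by linarith
    also have "\<dots> \<le> max M (2 + \<bar>l\<bar>) + ln y" by simp
    finally show ?thesis using True by simp
  next
    case False
    then show ?thesis using M [of y] that by (auto simp: le_max_iff_disj)
  qed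
  moreover have "max M (2 + \<bar>l\<bar>) \<ge> 0" by (simp add: le_max_iff_disj)
  ultimately show ?thesis by blast
qed

section \<open>Tail integrals of g(xi) / xi as expectations of the cosine integral\<close>

lemma integral_cos_over:
  assumes "0 < s" "s \<le> R" "x \<noteq> 0"
  shows "((\<lambda>\<xi>. cos (\<xi> * x) / \<xi>) has_integral
           (ln (R * \<bar>x\<bar>) + cin (R * \<bar>x\<bar>)) - (ln (s * \<bar>x\<bar>) + cin (s * \<bar>x\<bar>))) {s..R}"
proof (rule fundamental_theorem_of_calculus [OF assms(2)])
  fix \<xi> assume \<xi>: "\<xi> \<in> {s..R}"
  have "((\<lambda>\<xi>. ln (\<xi> * \<bar>x\<bar>) + cin (\<xi> * \<bar>x\<bar>)) has_real_derivative
      cos (\<xi> * \<bar>x\<bar>) / (\<xi> * \<bar>x\<bar>) * \<bar>x\<bar>) (at \<xi> within {s..R})"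
    by (rule DERIV_chain2 [OF DERIV_ln_plus_cin])
       (use \<xi> assms in \<open>auto intro!: derivative_eq_intros\<close>)
  moreover have "cos (\<xi> * \<bar>x\<bar>) / (\<xi> * \<bar>x\<bar>) * \<bar>x\<bar> = cos (\<xi> * x) / \<xi>"
    using assms by (cases "x > 0") auto
  ultimately show "((\<lambda>\<xi>. ln (\<xi> * \<bar>x\<bar>) + cin (\<xi> * \<bar>x\<bar>)) has_vector_derivative
      cos (\<xi> * x) / \<xi>) (at \<xi> within {s..R})"
    by (simp add: has_real_derivative_iff_has_vector_derivative)
qed

text \<open>On the bounded interval the integrand is at most 1 / s in modulus, which is what Fubini
  needs. The inner integral is evaluated by the antiderivative \<open>ln + cin\<close>.\<close>

lemma (in prob_space) integral_expectation_cos_over: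
  assumes [measurable]: "X \<in> borel_measurable M" and "0 < s" "s \<le> R" and nz: "AE \<omega> in M. X \<omega> \<noteq> 0"
  shows "integral {s..R} (\<lambda>\<xi>. expectation (\<lambda>\<omega>. cos (\<xi> * X \<omega>)) / \<xi>) =
    expectation (\<lambda>\<omega>. (ln (R * \<bar>X \<omega>\<bar>) + cin (R * \<bar>X \<omega>\<bar>)) - (ln (s * \<bar>X \<omega>\<bar>) + cin (s * \<bar>X \<omega>\<bar>)))"
proof -
  let ?f = "\<lambda>\<omega> \<xi>. indicator {s..R} \<xi> * (cos (\<xi> * X \<omega>) / \<xi>)"
  interpret P: pair_sigma_finite M lborel ..
  have int: "integrable (M \<Otimes>\<^sub>M lborel) (\<lambda>(\<omega>, \<xi>). ?f \<omega> \<xi>)"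
  proof (rule P.Fubini_integrable)
    show "(\<lambda>(\<omega>, \<xi>). ?f \<omega> \<xi>) \<in> borel_measurable (M \<Otimes>\<^sub>M lborel)" by measurable
    have 1: "integrable lborel (?f \<omega>)" for \<omega>
    proof -
      have "set_integrable lborel {s..R} (\<lambda>\<xi>. cos (\<xi> * X \<omega>) / \<xi>)"
        by (rule borel_integrable_atLeastAtMost')
           (use \<open>0 < s\<close> in \<open>auto intro!: continuous_intros\<close>)
      then show ?thesis by (simp add: set_integrable_def)
    qed
    then show "AE \<omega> in M. integrable lborel (\<lambda>\<xi>. case (\<omega>, \<xi>) of (\<omega>, \<xi>) \<Rightarrow> ?f \<omega> \<xi>)" by simp
    have "(\<integral>\<xi>. norm (?f \<omega> \<xi>) \<partial>lborel) \<le> (\<integral>\<xi>. indicator {s..R} \<xi> * (1 / s) \<partial>lborel)" for \<omega>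
    proof (rule integral_mono)
      show "integrable lborel (\<lambda>\<xi>. norm (?f \<omega> \<xi>))" using 1 by (rule integrable_norm)
      show "integrable lborel (\<lambda>\<xi>. indicat_real {s..R} \<xi> * (1 / s))"
        by (intro integrable_mult_left) (auto simp: integrable_indicator_iff emeasure_lborel_Icc_eq)
      show "norm (?f \<omega> \<xi>) \<le> indicat_real {s..R} \<xi> * (1 / s)" for \<xi>
        using \<open>0 < s\<close> by (auto simp: indicator_def intro!: frac_le)
    qed
    then show "integrable M (\<lambda>\<omega>. \<integral>\<xi>. norm (case (\<omega>, \<xi>) of (\<omega>, \<xi>) \<Rightarrow> ?f \<omega> \<xi>) \<partial>lborel)"
      by (intro integrable_const_bound [where B = "\<integral>\<xi>. indicator {s..R} \<xi> * (1 / s) \<partial>lborel"]) auto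
  qed
  have inner: "(\<integral>\<xi>. ?f \<omega> \<xi> \<partial>lborel) =
      (ln (R * \<bar>X \<omega>\<bar>) + cin (R * \<bar>X \<omega>\<bar>)) - (ln (s * \<bar>X \<omega>\<bar>) + cin (s * \<bar>X \<omega>\<bar>))" if "X \<omega> \<noteq> 0" for \<omega>
  proof -
    have "set_integrable lborel {s..R} (\<lambda>\<xi>. cos (\<xi> * X \<omega>) / \<xi>)"
      by (rule borel_integrable_atLeastAtMost')
         (use \<open>0 < s\<close> in \<open>auto intro!: continuous_intros\<close>)
    from set_borel_integral_eq_integral(2) [OF this] show ?thesis
      using integral_cos_over [OF assms(2,3) that] by (auto simp: set_lebesgue_integral_def integral_unique)
  qed
  have eq: "(\<integral>\<omega>. ?f \<omega> \<xi> \<partial>M) = indicator {s..R} \<xi> * (expectation (\<lambda>\<omega>. cos (\<xi> * X \<omega>)) / \<xi>)" for \<xi>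
    by simp
  have "set_integrable lborel {s..R} (\<lambda>\<xi>. expectation (\<lambda>\<omega>. cos (\<xi> * X \<omega>)) / \<xi>)"
    using P.integrable_snd [OF int] unfolding eq by (simp add: set_integrable_def)
  from set_borel_integral_eq_integral(2) [OF this]
  have "integral {s..R} (\<lambda>\<xi>. expectation (\<lambda>\<omega>. cos (\<xi> * X \<omega>)) / \<xi>) = (\<integral>\<xi>. (\<integral>\<omega>. ?f \<omega> \<xi> \<partial>M) \<partial>lborel)"
    unfolding eq by (simp add: set_lebesgue_integral_def)
  also have "\<dots> = (\<integral>\<omega>. (\<integral>\<xi>. ?f \<omega> \<xi> \<partial>lborel) \<partial>M)"
    by (rule P.Fubini_integral [OF int])
  also have "\<dots> = expectation (\<lambda>\<omega>. (ln (R * \<bar>X \<omega>\<bar>) + cin (R * \<bar>X \<omega>\<bar>)) - (ln (s * \<bar>X \<omega>\<bar>) + cin (s * \<bar>X \<omega>\<bar>)))"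
    by (rule integral_cong_AE) (use nz inner in \<open>auto elim!: AE_mp\<close>)
  finally show ?thesis .
qed

lemma (in prob_space) integrable_cin:
  assumes [measurable]: "X \<in> borel_measurable M" and nz: "AE \<omega> in M. X \<omega> \<noteq> 0"
    and int: "integrable M (\<lambda>\<omega>. ln \<bar>X \<omega>\<bar>)"
    and B: "B \<ge> 0" "\<And>y. y > 0 \<Longrightarrow> \<bar>cin y\<bar> \<le> B + (if y \<ge> 1 then ln y else 0)"
    and "s > 0"
  shows "integrable M (\<lambda>\<omega>. cin (s * \<bar>X \<omega>\<bar>))"
proof -
  have "integrable M (\<lambda>\<omega>. B + \<bar>ln s\<bar> + \<bar>ln \<bar>X \<omega>\<bar>\<bar>)" using int by auto
  then show ?thesis
  proof (rule Bochner_Integration.integrable_bound)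
    show "AE \<omega> in M. norm (cin (s * \<bar>X \<omega>\<bar>)) \<le> norm (B + \<bar>ln s\<bar> + \<bar>ln \<bar>X \<omega>\<bar>\<bar>)"
      using nz
    proof eventually_elim
      case (elim \<omega>)
      then have pos: "s * \<bar>X \<omega>\<bar> > 0" and ln: "ln (s * \<bar>X \<omega>\<bar>) = ln s + ln \<bar>X \<omega>\<bar>"
        using \<open>s > 0\<close> by (auto simp: ln_mult)
      have "\<bar>cin (s * \<bar>X \<omega>\<bar>)\<bar> \<le> B + \<bar>ln (s * \<bar>X \<omega>\<bar>)\<bar>"
        using B(2) [OF pos] by (cases "s * \<bar>X \<omega>\<bar> \<ge> 1") auto
      also have "\<dots> \<le> B + (\<bar>ln s\<bar> + \<bar>ln \<bar>X \<omega>\<bar>\<bar>)"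
        unfolding ln by (intro add_left_mono abs_triangle_ineq)
      finally show ?case using \<open>B \<ge> 0\<close> by simp
    qed
  qed auto
qed

text \<open>As R grows, the upper boundary term tends to \<open>l\<close> for each outcome with X
  nonzero, and the lower one stays. The constant \<open>l\<close> is a parameter because the lemma
  is first needed, for the exponential law, to find its value.\<close>

lemma (in prob_space) improper_integral_expectation_cos:
  assumes [measurable]: "X \<in> borel_measurable M" and nz: "AE \<omega> in M. X \<omega> \<noteq> 0"
    and int: "integrable M (\<lambda>\<omega>. ln \<bar>X \<omega>\<bar>)"
    and l: "\<And>y. y > 0 \<Longrightarrow> \<bar>ln y + cin y - l\<bar> \<le> 2 / y"
    and g: "\<And>\<xi>. g \<xi> = expectation (\<lambda>\<omega>. cos (\<xi> * X \<omega>))"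
    and "s > 0"
  shows "((\<lambda>R. integral {s..R} (\<lambda>\<xi>. g \<xi> / \<xi>)) \<longlongrightarrow>
            l - ln s - expectation (\<lambda>\<omega>. ln \<bar>X \<omega>\<bar>) - expectation (\<lambda>\<omega>. cin (s * \<bar>X \<omega>\<bar>))) at_top"
proof -
  obtain B where B: "B \<ge> 0" "\<And>y. y > 0 \<Longrightarrow> \<bar>cin y\<bar> \<le> B + (if y \<ge> 1 then ln y else 0)"
    using cin_bound [OF l] by blast
  let ?h = "\<lambda>R \<omega>. ln (R * \<bar>X \<omega>\<bar>) + cin (R * \<bar>X \<omega>\<bar>)"
  have hint: "integrable M (?h R)" and hexp: "expectation (?h R) =
      ln R + expectation (\<lambda>\<omega>. ln \<bar>X \<omega>\<bar>) + expectation (\<lambda>\<omega>. cin (R * \<bar>X \<omega>\<bar>))" if "R > 0" for R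
  proof -
    have cint: "integrable M (\<lambda>\<omega>. cin (R * \<bar>X \<omega>\<bar>))"
      by (rule integrable_cin [OF assms(1) nz int B that])
    have eq: "AE \<omega> in M. (ln R + ln \<bar>X \<omega>\<bar>) + cin (R * \<bar>X \<omega>\<bar>) = ?h R \<omega>"
      using nz by eventually_elim (use that in \<open>simp add: ln_mult\<close>)
    show "integrable M (?h R)"
      by (rule integrable_cong_AE_imp [OF _ _ eq]) (use cint int in auto)
    have "expectation (?h R) = expectation (\<lambda>\<omega>. (ln R + ln \<bar>X \<omega>\<bar>) + cin (R * \<bar>X \<omega>\<bar>))"
      by (rule integral_cong_AE) (use eq in \<open>auto elim!: AE_mp\<close>)
    then show "expectation (?h R) =
      ln R + expectation (\<lambda>\<omega>. ln \<bar>X \<omega>\<bar>) + expectation (\<lambda>\<omega>. cin (R * \<bar>X \<omega>\<bar>))"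
      using int cint by (simp add: prob_space)
  qed
  \<comment> \<open>A majorant uniform in R. If R x >= 1, the asymptotics bound the sum by a
    constant; otherwise x <= R x < 1, so ln (R x) lies between ln x and 0.\<close>
  have bound: "\<bar>ln (R * x) + cin (R * x)\<bar> \<le> (\<bar>l\<bar> + 2 + B) + \<bar>ln x\<bar>" if "R \<ge> 1" "x > 0" for R x
  proof (cases "R * x \<ge> 1")
    case True
    then have "2 / (R * x) \<le> 2" by (simp add: field_simps)
    moreover have "\<bar>ln (R * x) + cin (R * x) - l\<bar> \<le> 2 / (R * x)" using l that by simp
    ultimately show ?thesis using B(1) by linarith
  next
    case False
    have "x \<le> R * x" using that by simp
    then have "ln x \<le> ln (R * x)" using that by simp
    moreover have "ln (R * x) \<le> 0" using that False by simp
    moreover have "\<bar>cin (R * x)\<bar> \<le> B" using B(2) [of "R * x"] that False by simp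
    ultimately show ?thesis by linarith
  qed
  have w: "integrable M (\<lambda>\<omega>. (\<bar>l\<bar> + 2 + B) + \<bar>ln \<bar>X \<omega>\<bar>\<bar>)" using int by auto
  have "((\<lambda>R. expectation (?h R)) \<longlongrightarrow> expectation (\<lambda>\<omega>. l)) at_top"
  proof (rule integral_dominated_convergence_at_top [OF _ _ w])
    show "\<forall>\<^sub>F R in at_top. AE \<omega> in M. norm (?h R \<omega>) \<le> (\<bar>l\<bar> + 2 + B) + \<bar>ln \<bar>X \<omega>\<bar>\<bar>"
      using eventually_ge_at_top [of 1]
    proof eventually_elim
      case (elim R)
      show ?case using nz by eventually_elim (use bound [OF elim] in auto)
    qed
    show "AE \<omega> in M. ((\<lambda>R. ?h R \<omega>) \<longlongrightarrow> l) at_top"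
      using nz
    proof eventually_elim
      case (elim \<omega>)
      have "((\<lambda>R. (2 / \<bar>X \<omega>\<bar>) / R) \<longlongrightarrow> 0) at_top"
        by (rule real_tendsto_divide_at_top [OF tendsto_const filterlim_ident])
      moreover have "\<forall>\<^sub>F R in at_top. norm (?h R \<omega> - l) \<le> (2 / \<bar>X \<omega>\<bar>) / R"
        using eventually_gt_at_top [of 0]
      proof eventually_elim
        case (elim R)
        with \<open>X \<omega> \<noteq> 0\<close> have "R * \<bar>X \<omega>\<bar> > 0" by simp
        from l [OF this] show ?case by (simp add: mult.commute)
      qed
      ultimately have "((\<lambda>R. ?h R \<omega> - l) \<longlongrightarrow> 0) at_top"
        by (rule Lim_null_comparison [rotated])
      then show ?case by (simp add: LIM_zero_iff)
    qed
  qed auto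
  then have "((\<lambda>R. expectation (?h R) - expectation (?h s)) \<longlongrightarrow> l - expectation (?h s)) at_top"
    by (intro tendsto_intros) (simp add: prob_space)
  moreover have "\<forall>\<^sub>F R in at_top. expectation (?h R) - expectation (?h s) = integral {s..R} (\<lambda>\<xi>. g \<xi> / \<xi>)"
    using eventually_ge_at_top [of s]
  proof eventually_elim
    case (elim R)
    with \<open>s > 0\<close> have "R > 0" by simp
    show ?case
      unfolding g integral_expectation_cos_over [OF assms(1) \<open>s > 0\<close> elim nz]
      using hint [OF \<open>s > 0\<close>] hint [OF \<open>R > 0\<close>] by simp
  qed
  ultimately have "((\<lambda>R. integral {s..R} (\<lambda>\<xi>. g \<xi> / \<xi>)) \<longlongrightarrow> l - expectation (?h s)) at_top"
    by (rule Lim_transform_eventually)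
  then show ?thesis by (simp only: hexp [OF \<open>s > 0\<close>] diff_diff_eq)
qed

text \<open>Pointwise this is continuity of \<open>cin\<close> at 0. For s <= 1 the logarithm in the
  bound for \<open>cin\<close> is at most ln |X|, so the majorant does not depend on s.\<close>

lemma (in prob_space) expectation_cin_tendsto_0:
  assumes [measurable]: "X \<in> borel_measurable M" and nz: "AE \<omega> in M. X \<omega> \<noteq> 0"
    and int: "integrable M (\<lambda>\<omega>. ln \<bar>X \<omega>\<bar>)"
    and l: "\<And>y. y > 0 \<Longrightarrow> \<bar>ln y + cin y - l\<bar> \<le> 2 / y"
  shows "((\<lambda>s. expectation (\<lambda>\<omega>. cin (s * \<bar>X \<omega>\<bar>))) \<longlongrightarrow> 0) (at_right 0)"
proof -
  obtain B where B: "B \<ge> 0" "\<And>y. y > 0 \<Longrightarrow> \<bar>cin y\<bar> \<le> B + (if y \<ge> 1 then ln y else 0)"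
    using cin_bound [OF l] by blast
  have w: "integrable M (\<lambda>\<omega>. B + \<bar>ln \<bar>X \<omega>\<bar>\<bar>)" using int by auto
  \<comment> \<open>The substitution s = 1 / R turns the limit at 0 from the right into one at
    infinity, the form that the dominated convergence rule takes.\<close>
  have "((\<lambda>R. expectation (\<lambda>\<omega>. cin (inverse R * \<bar>X \<omega>\<bar>))) \<longlongrightarrow> expectation (\<lambda>\<omega>. 0)) at_top"
  proof (rule integral_dominated_convergence_at_top [OF _ _ w])
    show "\<forall>\<^sub>F R in at_top. AE \<omega> in M. norm (cin (inverse R * \<bar>X \<omega>\<bar>)) \<le> B + \<bar>ln \<bar>X \<omega>\<bar>\<bar>"
      using eventually_ge_at_top [of 1]
    proof eventually_elim
      case (elim R)
      show ?case using nz
      proof eventually_elim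
        fix \<omega> assume "X \<omega> \<noteq> 0"
        then have pos: "inverse R * \<bar>X \<omega>\<bar> > 0" using elim by simp
        have "inverse R * \<bar>X \<omega>\<bar> \<le> \<bar>X \<omega>\<bar>"
          using elim by (intro mult_left_le_one_le) (auto simp: field_simps)
        then have "ln (inverse R * \<bar>X \<omega>\<bar>) \<le> ln \<bar>X \<omega>\<bar>" using pos by simp
        then show "norm (cin (inverse R * \<bar>X \<omega>\<bar>)) \<le> B + \<bar>ln \<bar>X \<omega>\<bar>\<bar>"
          using B(2) [OF pos] by (cases "inverse R * \<bar>X \<omega>\<bar> \<ge> 1") (simp_all only: if_True if_False real_norm_def, linarith+)
      qed
    qed
    show "AE \<omega> in M. ((\<lambda>R. cin (inverse R * \<bar>X \<omega>\<bar>)) \<longlongrightarrow> 0) at_top"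
    proof (rule AE_I2)
      fix \<omega>
      have "((\<lambda>R. inverse R * \<bar>X \<omega>\<bar>) \<longlongrightarrow> 0) at_top"
        by (intro tendsto_mult_left_zero tendsto_inverse_0_at_top filterlim_ident)
      from isCont_tendsto_compose [OF isCont_cin this]
      show "((\<lambda>R. cin (inverse R * \<bar>X \<omega>\<bar>)) \<longlongrightarrow> 0) at_top" by simp
    qed
  qed auto
  then show ?thesis by (simp add: filterlim_at_right_to_top)
qed

section \<open>Log-means and the constant of the cosine integral\<close>

text \<open>The step sizes are powers of 1/2 so that passing to the next quotient takes a square
  root of Y^z, which makes monotonicity elementary below.\<close>

lemma DERIV_imp_dyadic_quotients:
  fixes F :: "real \<Rightarrow> real"
  assumes "(F has_real_derivative D) (at 0 within {0..})"
  shows "(\<lambda>n. 2 ^ n * (F ((1 / 2) ^ n) - F 0)) \<longlonglongrightarrow> D"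
proof -
  have "((\<lambda>y. (F y - F 0) / (y - 0)) \<longlongrightarrow> D) (at 0 within {0..})"
    using assms by (simp add: has_field_derivative_iff)
  moreover have "LIM n sequentially. (1 / 2 :: real) ^ n :> at 0 within {0..}"
    by (auto simp: filterlim_at intro!: LIMSEQ_realpow_zero)
  ultimately have "(\<lambda>n. (F ((1 / 2) ^ n) - F 0) / ((1 / 2) ^ n - 0)) \<longlonglongrightarrow> D"
    by (rule filterlim_compose)
  moreover have "(F ((1 / 2) ^ n) - F 0) / ((1 / 2) ^ n - 0) = 2 ^ n * (F ((1 / 2) ^ n) - F 0)" for n
    by (simp add: power_one_over)
  ultimately show ?thesis by simp
qed

text \<open>This differentiates E Y^z at z = 0 from the right. Along z = (1/2)^n the quotients (1 -
  Y^z) / z increase to - ln Y, so monotone convergence yields integrability and value together. With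
  u = Y^(z/2), consecutive quotients differ by 2^n (1 - u)^2.\<close>

lemma (in prob_space) has_bochner_integral_ln:
  assumes [measurable]: "Y \<in> borel_measurable M" and pos: "AE \<omega> in M. Y \<omega> > 0"
    and F: "\<And>z. 0 \<le> z \<Longrightarrow> has_bochner_integral M (\<lambda>\<omega>. Y \<omega> powr z) (F z)"
    and D: "(F has_real_derivative D) (at 0 within {0..})"
  shows "has_bochner_integral M (\<lambda>\<omega>. ln (Y \<omega>)) D"
proof -
  let ?f = "\<lambda>n \<omega>. 2 ^ n * (1 - Y \<omega> powr ((1 / 2) ^ n))"
  have int: "integrable M (\<lambda>\<omega>. Y \<omega> powr z)" and val: "expectation (\<lambda>\<omega>. Y \<omega> powr z) = F z" if "z \<ge> 0" for z
    using F [OF that] by (auto simp: has_bochner_integral_iff)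
  \<comment> \<open>Positivity matters here: \<open>0 powr 0\<close> is 0 by convention.\<close>
  have "AE \<omega> in M. Y \<omega> powr 0 = 1" using pos by eventually_elim auto
  then have "expectation (\<lambda>\<omega>. Y \<omega> powr 0) = expectation (\<lambda>\<omega>. 1)"
    by (intro integral_cong_AE) auto
  then have "F 0 = 1" using val [of 0] prob_space by simp
  have i: "integrable M (?f n)" for n
    by (intro integrable_mult_right Bochner_Integration.integrable_diff int) auto
  have m: "AE \<omega> in M. mono (\<lambda>n. ?f n \<omega>)"
    using pos
  proof eventually_elim
    case (elim \<omega>)
    show ?case
    proof (rule incseq_SucI)
      fix n
      define u where "u = Y \<omega> powr ((1 / 2) ^ Suc n)"
      have "Y \<omega> powr ((1 / 2) ^ n) = u\<^sup>2"
        by (simp add: u_def power2_eq_square flip: powr_add)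
      moreover have "2 ^ n * (1 - u\<^sup>2) \<le> 2 ^ Suc n * (1 - u)"
      proof -
        have "2 ^ Suc n * (1 - u) - 2 ^ n * (1 - u\<^sup>2) = 2 ^ n * (1 - u)\<^sup>2"
          by (simp add: power2_eq_square algebra_simps)
        moreover have "\<dots> \<ge> 0" by simp
        ultimately show ?thesis by linarith
      qed
      ultimately show "?f n \<omega> \<le> ?f (Suc n) \<omega>" unfolding u_def by simp
    qed
  qed
  have lim: "AE \<omega> in M. (\<lambda>n. ?f n \<omega>) \<longlonglongrightarrow> - ln (Y \<omega>)"
    using pos
  proof eventually_elim
    case (elim \<omega>)
    have "((\<lambda>z. Y \<omega> powr z) has_real_derivative ln (Y \<omega>)) (at 0 within {0..})"
    proof -
      have "((\<lambda>z. exp (z * ln (Y \<omega>))) has_real_derivative ln (Y \<omega>)) (at 0 within {0..})"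
        by (auto intro!: derivative_eq_intros)
      moreover have "(\<lambda>z. exp (z * ln (Y \<omega>))) = (\<lambda>z. Y \<omega> powr z)"
        using elim by (auto simp: powr_def)
      ultimately show ?thesis by simp
    qed
    from tendsto_minus [OF DERIV_imp_dyadic_quotients [OF this]] show ?case
      using elim by (simp add: right_diff_distrib)
  qed
  have "expectation (?f n) = - (2 ^ n * (F ((1 / 2) ^ n) - F 0))" for n
    using int [of "(1 / 2) ^ n"] \<open>F 0 = 1\<close> by (simp add: val prob_space algebra_simps)
  with tendsto_minus [OF DERIV_imp_dyadic_quotients [OF D]]
  have ilim: "(\<lambda>n. expectation (?f n)) \<longlonglongrightarrow> - D" by simp
  have "has_bochner_integral M (\<lambda>\<omega>. - ln (Y \<omega>)) (- D)"
    unfolding has_bochner_integral_iff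
    by (intro conjI integrable_monotone_convergence [OF i m lim ilim] integral_monotone_convergence [OF i m lim ilim]) auto
  from has_bochner_integral_minus [OF this] show ?thesis by simp
qed

section \<open>The exponential law as a test case for the constant\<close>

lemma prob_space_exponential: "prob_space (density lborel (exponential_density 1))"
  by (rule prob_space_exponential_density) simp

lemma AE_exponential_pos: "AE x in density lborel (exponential_density 1). 0 < x"
  using AE_lborel_singleton [of "0::real"]
  by (subst AE_density) (auto simp: exponential_density_def)

text \<open>The moment of order z is Gamma (1 + z), and its derivative at z = 0 is Gamma'(1) =
  -gamma.\<close>

lemma has_bochner_integral_ln_exponential:
  "has_bochner_integral (density lborel (exponential_density 1)) ln (- euler_mascheroni)"
proof -
  interpret prob_space "density lborel (exponential_density 1)"
    by (rule prob_space_exponential)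
  show ?thesis
  proof (rule has_bochner_integral_ln [where Y = "\<lambda>x. x" and F = "\<lambda>z. Gamma (1 + z)", simplified])
    show "AE x in density lborel (exponential_density 1). 0 < x" by (rule AE_exponential_pos)
    show "((\<lambda>z. Gamma (1 + z)) has_real_derivative - euler_mascheroni) (at 0 within {0..})"
      by (auto intro!: derivative_eq_intros)
  next
    fix z :: real assume "z \<ge> 0"
    then have pos: "1 + z > 0" by simp
    have eq: "exponential_density 1 x * x powr z = indicator {0..} x * x powr (1 + z - 1) / exp x" for x
      by (simp add: exponential_density_def indicator_def exp_minus divide_inverse)
    show "has_bochner_integral (density lborel (exponential_density 1)) (\<lambda>x. x powr z) (Gamma (1 + z))"
    proof (rule has_bochner_integral_density)
      show "has_bochner_integral lborel (\<lambda>x. exponential_density 1 x *\<^sub>R x powr z) (Gamma (1 + z))"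
      proof (rule has_bochner_integral_nn_integral)
        show "(\<integral>\<^sup>+x. ennreal (exponential_density 1 x *\<^sub>R x powr z) \<partial>lborel) = ennreal (Gamma (1 + z))"
          using Gamma_conv_nn_integral_real [OF pos] by (simp only: real_scaleR_def eq)
        show "0 \<le> Gamma (1 + z)" using pos by (simp add: Gamma_real_pos less_imp_le)
      qed (auto simp: exponential_density_def)
    qed (auto simp: exponential_density_def)
  qed
qed

lemma expectation_cos_exponential:
  "(\<integral>x. cos (\<xi> * x) \<partial>density lborel (exponential_density 1)) = 1 / (1 + \<xi>\<^sup>2)"
proof -
  \<comment> \<open>The real part of exp ((i xi - 1) x) / (i xi - 1), an antiderivative of exp (- x)
    cos (xi x).\<close>
  let ?F = "\<lambda>x. exp (- x) * (\<xi> * sin (\<xi> * x) - cos (\<xi> * x)) / (1 + \<xi>\<^sup>2)"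
  have nz: "1 + \<xi>\<^sup>2 \<noteq> 0" by (metis add_pos_nonneg less_irrefl zero_le_power2 zero_less_one)
  have "(\<integral>x. cos (\<xi> * x) \<partial>density lborel (exponential_density 1)) =
      (\<integral>x. exponential_density 1 x *\<^sub>R cos (\<xi> * x) \<partial>lborel)"
    by (rule integral_density) (auto simp: exponential_density_def)
  also have "\<dots> = (\<integral>x. indicator {0<..} x *\<^sub>R (exp (- x) * cos (\<xi> * x)) \<partial>lborel)"
    using AE_lborel_singleton [of "0::real"]
    by (intro integral_cong_AE) (auto simp: exponential_density_def indicator_def elim!: AE_mp)
  also have "\<dots> = (LBINT x=0..\<infinity>. exp (- x) * cos (\<xi> * x))"
    by (simp add: interval_lebesgue_integral_0_infty set_lebesgue_integral_def)
  also have "\<dots> = 0 - (- 1 / (1 + \<xi>\<^sup>2))"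
  proof (rule interval_integral_FTC_integrable [where F = ?F])
    show "(?F has_vector_derivative exp (- x) * cos (\<xi> * x)) (at x)" for x
    proof -
      have "((\<lambda>x. exp (- x) * (\<xi> * sin (\<xi> * x) - cos (\<xi> * x))) has_real_derivative
          (1 + \<xi>\<^sup>2) * (exp (- x) * cos (\<xi> * x))) (at x)"
        by (auto intro!: derivative_eq_intros simp: power2_eq_square algebra_simps)
      from DERIV_cdivide [OF this, of "1 + \<xi>\<^sup>2"] show ?thesis
        using nz by (simp flip: has_real_derivative_iff_has_vector_derivative)
    qed
    show "set_integrable lborel (einterval 0 \<infinity>) (\<lambda>x. exp (- x) * cos (\<xi> * x))"
    proof -
      have "integrable lborel (\<lambda>x::real. exp (- x) * indicator {0..} x)"
        using has_bochner_integral_I0i_power_exp_m' [of 0] by (simp add: has_bochner_integral_iff)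
      then show ?thesis unfolding set_integrable_def
        by (rule Bochner_Integration.integrable_bound)
           (auto simp: einterval_def indicator_def abs_mult mult_left_le)
    qed
    have "isCont ?F 0" using nz by (auto intro!: continuous_intros)
    then have "(?F \<longlongrightarrow> - 1 / (1 + \<xi>\<^sup>2)) (at_right 0)"
      by (auto simp: isCont_def intro: filterlim_at_split[THEN iffD1, THEN conjunct2])
    then show "((?F \<circ> real_of_ereal) \<longlongrightarrow> - 1 / (1 + \<xi>\<^sup>2)) (at_right 0)"
      unfolding zero_ereal_def by (simp only: ereal_tendsto_simps1)
    have "((\<lambda>x. exp (- x) * ((\<bar>\<xi>\<bar> + 1) / (1 + \<xi>\<^sup>2))) \<longlongrightarrow> 0) at_top"
      by (intro tendsto_mult_left_zero filterlim_compose [OF exp_at_bot] filterlim_uminus_at_bot_at_top)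
    then have "(?F \<longlongrightarrow> 0) at_top"
    proof (rule Lim_null_comparison [rotated])
      have "\<bar>?F x\<bar> \<le> exp (- x) * ((\<bar>\<xi>\<bar> + 1) / (1 + \<xi>\<^sup>2))" for x
      proof -
        have "\<bar>\<xi> * sin (\<xi> * x) - cos (\<xi> * x)\<bar> \<le> \<bar>\<xi> * sin (\<xi> * x)\<bar> + \<bar>cos (\<xi> * x)\<bar>"
          by (rule abs_triangle_ineq4)
        also have "\<dots> \<le> \<bar>\<xi>\<bar> + 1"
          by (intro add_mono) (auto simp: abs_mult mult_left_le)
        finally show ?thesis
          by (simp add: abs_mult divide_right_mono)
      qed
      then show "\<forall>\<^sub>F x in at_top. norm (?F x) \<le> exp (- x) * ((\<bar>\<xi>\<bar> + 1) / (1 + \<xi>\<^sup>2))"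
        by simp
    qed
    then show "((?F \<circ> real_of_ereal) \<longlongrightarrow> 0) (at_left \<infinity>)"
      by (simp only: ereal_tendsto_simps1)
  qed auto
  finally show ?thesis by simp
qed

text \<open>The exponential law has \<open>E ln X = - euler_mascheroni\<close> and an explicit tail integral, which
  identifies the constant in the asymptotics of the cosine integral.\<close>

lemma cosine_integral_bound:
  assumes "y > 0"
  shows "\<bar>ln y + cin y + euler_mascheroni\<bar> \<le> 2 / y"
proof -
  obtain l where l: "\<And>y. y > 0 \<Longrightarrow> \<bar>ln y + cin y - l\<bar> \<le> 2 / y"
    using ln_plus_cin_converges by blast
  interpret prob_space "density lborel (exponential_density 1)"
    by (rule prob_space_exponential)
  let ?E = "\<lambda>f :: real \<Rightarrow> real. expectation f"
  have nz: "AE x in density lborel (exponential_density 1). x \<noteq> 0"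
    using AE_exponential_pos by eventually_elim auto
  have ln_abs: "has_bochner_integral (density lborel (exponential_density 1)) (\<lambda>x. ln \<bar>x\<bar>) (- euler_mascheroni)"
  proof (rule has_bochner_integral_cong_AE [THEN iffD2, OF _ _ _ has_bochner_integral_ln_exponential])
    show "AE x in density lborel (exponential_density 1). ln \<bar>x\<bar> = ln x"
      using AE_exponential_pos by eventually_elim auto
  qed auto
  then have int: "integrable (density lborel (exponential_density 1)) (\<lambda>x. ln \<bar>x\<bar>)"
    and val: "?E (\<lambda>x. ln \<bar>x\<bar>) = - euler_mascheroni"
    by (auto simp: has_bochner_integral_iff)
  \<comment> \<open>Partial fractions: 1 / (xi (1 + xi^2)) = 1 / xi - xi / (1 + xi^2). The
    antiderivative \<open>?G\<close> vanishes at infinity.\<close>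
  have tail: "((\<lambda>R. integral {s..R} (\<lambda>\<xi>. 1 / (1 + \<xi>\<^sup>2) / \<xi>)) \<longlongrightarrow> ln (1 + s\<^sup>2) / 2 - ln s) at_top"
    if "s > 0" for s :: real
  proof -
    let ?G = "\<lambda>\<xi>::real. ln \<xi> - ln (1 + \<xi>\<^sup>2) / 2"
    have "((\<lambda>R::real. 1 / R\<^sup>2) \<longlongrightarrow> 0) at_top"
      by (rule real_tendsto_divide_at_top [OF tendsto_const filterlim_pow_at_top [OF _ filterlim_ident]]) simp
    then have "((\<lambda>R::real. - ln (1 + 1 / R\<^sup>2) / 2) \<longlongrightarrow> - ln (1 + 0) / 2) at_top"
      by (intro tendsto_divide tendsto_minus tendsto_ln tendsto_add tendsto_const) auto
    then have "((\<lambda>R::real. - ln (1 + 1 / R\<^sup>2) / 2) \<longlongrightarrow> 0) at_top"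
      by simp
    moreover have "\<forall>\<^sub>F R in at_top. - ln (1 + 1 / R\<^sup>2) / 2 = ?G R"
      using eventually_gt_at_top [of 0]
    proof eventually_elim
      case (elim R)
      have "1 + 1 / R\<^sup>2 = (1 + R\<^sup>2) / R\<^sup>2" using elim by (simp add: field_simps)
      moreover have "1 + R\<^sup>2 > 0" by (simp add: add_pos_nonneg)
      ultimately have "ln (1 + 1 / R\<^sup>2) = ln (1 + R\<^sup>2) - 2 * ln R"
        using elim by (simp add: ln_div ln_realpow)
      then show ?case by simp
    qed
    ultimately have "(?G \<longlongrightarrow> 0) at_top"
      by (rule Lim_transform_eventually)
    then have "((\<lambda>R. ?G R - ?G s) \<longlongrightarrow> 0 - ?G s) at_top"
      by (rule tendsto_diff [OF _ tendsto_const])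
    moreover have "\<forall>\<^sub>F R in at_top. ?G R - ?G s = integral {s..R} (\<lambda>\<xi>. 1 / (1 + \<xi>\<^sup>2) / \<xi>)"
      using eventually_ge_at_top [of s]
    proof eventually_elim
      case (elim R)
      have "((\<lambda>\<xi>. 1 / (1 + \<xi>\<^sup>2) / \<xi>) has_integral ?G R - ?G s) {s..R}"
      proof (rule fundamental_theorem_of_calculus [OF elim])
        fix \<xi> assume "\<xi> \<in> {s..R}"
        with that have "\<xi> > 0" by simp
        moreover have "1 + \<xi>\<^sup>2 > 0" by (simp add: add_pos_nonneg)
        moreover have "((\<lambda>\<xi>. 1 + \<xi>\<^sup>2) has_real_derivative 2 * \<xi>) (at \<xi> within {s..R})"
          by (auto intro!: derivative_eq_intros)
        ultimately have "((\<lambda>\<xi>. ln (1 + \<xi>\<^sup>2)) has_real_derivative 1 / (1 + \<xi>\<^sup>2) * (2 * \<xi>)) (at \<xi> within {s..R})"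
          by (intro DERIV_chain2 [OF DERIV_ln_divide])
        moreover have "(ln has_real_derivative 1 / \<xi>) (at \<xi> within {s..R})"
          using \<open>\<xi> > 0\<close> by (rule has_field_derivative_at_within [OF DERIV_ln_divide])
        ultimately have "(?G has_real_derivative 1 / \<xi> - 1 / (1 + \<xi>\<^sup>2) * (2 * \<xi>) / 2) (at \<xi> within {s..R})"
          by (intro DERIV_diff DERIV_cdivide)
        moreover have "c * (2 * \<xi>) / 2 = c * \<xi>" for c by simp
        moreover have "1 / \<xi> - 1 / (1 + \<xi>\<^sup>2) * \<xi> = 1 / (1 + \<xi>\<^sup>2) / \<xi>"
          using \<open>\<xi> > 0\<close> \<open>1 + \<xi>\<^sup>2 > 0\<close> by (simp add: field_simps power2_eq_square)
        ultimately show "(?G has_vector_derivative 1 / (1 + \<xi>\<^sup>2) / \<xi>) (at \<xi> within {s..R})"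
          by (simp only: has_real_derivative_iff_has_vector_derivative)
      qed
      then show ?case by (simp add: integral_unique)
    qed
    ultimately have "((\<lambda>R. integral {s..R} (\<lambda>\<xi>. 1 / (1 + \<xi>\<^sup>2) / \<xi>)) \<longlongrightarrow> 0 - ?G s) at_top"
      by (rule Lim_transform_eventually)
    then show ?thesis by simp
  qed
  \<comment> \<open>Two evaluations of the same tail integral. The terms ln s cancel, and letting s
    tend to 0 removes everything except l + gamma = 0.\<close>
  have eq: "ln (1 + s\<^sup>2) / 2 - ln s = l - ln s + euler_mascheroni - ?E (\<lambda>x. cin (s * \<bar>x\<bar>))" if "s > 0" for s
    using tendsto_unique [OF _ tail [OF that]
        improper_integral_expectation_cos [OF _ nz int l expectation_cos_exponential [symmetric] that]]
    by (simp add: val)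
  have "((\<lambda>s::real. ln (1 + s\<^sup>2) / 2 + ?E (\<lambda>x. cin (s * \<bar>x\<bar>))) \<longlongrightarrow> ln (1 + 0\<^sup>2) / 2 + 0) (at_right 0)"
    by (intro tendsto_intros expectation_cin_tendsto_0 [OF _ nz int l]) auto
  moreover have "\<forall>\<^sub>F s in at_right (0::real). ln (1 + s\<^sup>2) / 2 + ?E (\<lambda>x. cin (s * \<bar>x\<bar>)) = l + euler_mascheroni"
    using eventually_at_right_less [of 0]
  proof eventually_elim
    case (elim s)
    from eq [OF elim] show ?case by linarith
  qed
  ultimately have "((\<lambda>s. l + euler_mascheroni) \<longlongrightarrow> ln (1 + 0\<^sup>2) / 2 + 0) (at_right (0::real))"
    by (rule Lim_transform_eventually)
  then have "l = - euler_mascheroni"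
    by (simp add: tendsto_const_iff)
  with l [OF assms] show ?thesis by simp
qed

section \<open>Laws on the unit interval with Pochhammer moments\<close>

text \<open>Excluding mass at 0 keeps \<open>ln\<close> away from its default value, and the upper
  bound 1 makes - ln x nonnegative.\<close>

definition unit_law :: "real measure \<Rightarrow> bool" where
  "unit_law P \<longleftrightarrow> prob_space P \<and> sets P = sets borel \<and> (AE x in P. 0 < x \<and> x \<le> 1)"

text \<open>The mean of - ln x is taken in \<open>ennreal\<close> because its finiteness is not
  known in advance; interchange and additivity then need no integrability.\<close>

definition log_mean :: "real measure \<Rightarrow> ennreal" where
  "log_mean P = (\<integral>\<^sup>+x. ennreal (- ln x) \<partial>P)"

lemma unit_lawD:
  assumes "unit_law P"
  shows "prob_space P" "sets P = sets borel" "AE x in P. 0 < x \<and> x \<le> 1"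
  using assms by (auto simp: unit_law_def)

lemma unit_law_integrable_power:
  assumes "unit_law P"
  shows "integrable P (\<lambda>x. x ^ n)"
proof -
  interpret prob_space P using assms by (rule unit_lawD)
  note [measurable_cong] = unit_lawD(2) [OF assms]
  show ?thesis
  proof (rule integrable_const_bound [where B = 1])
    show "AE x in P. norm (x ^ n) \<le> 1"
      using unit_lawD(3) [OF assms] by eventually_elim (simp add: power_abs power_le_one)
  qed measurable
qed

text \<open>The right-hand side sees P only through its moments, so laws with equal moments have
  equal log-means. Nonnegativity of (1 - x)^n on the unit interval justifies integrating the
  logarithmic series termwise.\<close>

lemma log_mean_eq_suminf:
  assumes "unit_law P"
  shows "log_mean P = (\<Sum>n. ennreal ((\<Sum>k\<le>n. real (n choose k) * (- 1) ^ k * (\<integral>x. x ^ k \<partial>P)) / real n))"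
proof -
  interpret prob_space P using assms by (rule unit_lawD)
  note [measurable_cong] = unit_lawD(2) [OF assms]
  note unit = unit_lawD(3) [OF assms]
  have binom: "(1 - x) ^ n = (\<Sum>k\<le>n. real (n choose k) * (- 1) ^ k * x ^ k)" for x :: real and n
  proof -
    have "(1 - x) ^ n = (- x + 1) ^ n" by simp
    also have "\<dots> = (\<Sum>k\<le>n. real (n choose k) * (- x) ^ k * 1 ^ (n - k))"
      by (rule binomial_ring)
    also have "\<dots> = (\<Sum>k\<le>n. real (n choose k) * (- 1) ^ k * x ^ k)"
      by (intro sum.cong refl) (simp add: power_minus [of x])
    finally show ?thesis .
  qed
  \<comment> \<open>The term n = 0 is 0, since division by 0 gives 0; the logarithmic series used
    below has the same convention.\<close>
  have int: "has_bochner_integral P (\<lambda>x. (1 - x) ^ n / real n)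
      ((\<Sum>k\<le>n. real (n choose k) * (- 1) ^ k * (\<integral>x. x ^ k \<partial>P)) / real n)" for n
    unfolding binom
    by (intro has_bochner_integral_divide has_bochner_integral_sum has_bochner_integral_mult_right
        has_bochner_integral_integrable unit_law_integrable_power assms)
  have "log_mean P = (\<integral>\<^sup>+x. (\<Sum>n. ennreal ((1 - x) ^ n / real n)) \<partial>P)"
    unfolding log_mean_def
  proof (rule nn_integral_cong_AE)
    show "AE x in P. ennreal (- ln x) = (\<Sum>n. ennreal ((1 - x) ^ n / real n))"
      using unit
    proof eventually_elim
      case (elim x)
      have "(\<lambda>n. - ((- (x - 1)) ^ n) / real n) sums ln (1 + (x - 1))"
        by (rule ln_series') (use elim in auto)
      from sums_minus [OF this] have "(\<lambda>n. (1 - x) ^ n / real n) sums (- ln x)" by simp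
      then show ?case
        using elim by (subst suminf_ennreal2) (auto simp: sums_iff)
    qed
  qed
  also have "\<dots> = (\<Sum>n. \<integral>\<^sup>+x. ennreal ((1 - x) ^ n / real n) \<partial>P)"
    by (rule nn_integral_suminf) measurable
  also have "\<dots> = (\<Sum>n. ennreal ((\<Sum>k\<le>n. real (n choose k) * (- 1) ^ k * (\<integral>x. x ^ k \<partial>P)) / real n))"
  proof (intro suminf_cong)
    fix n
    show "(\<integral>\<^sup>+x. ennreal ((1 - x) ^ n / real n) \<partial>P) =
        ennreal ((\<Sum>k\<le>n. real (n choose k) * (- 1) ^ k * (\<integral>x. x ^ k \<partial>P)) / real n)"
      using int [of n] unit
      by (subst nn_integral_eq_integral) (auto simp: has_bochner_integral_iff elim!: AE_mp)
  qed
  finally show ?thesis .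
qed

lemma log_mean_cong:
  assumes "unit_law P" "unit_law Q" "\<And>n. (\<integral>x. x ^ n \<partial>P) = (\<integral>x. x ^ n \<partial>Q)"
  shows "log_mean P = log_mean Q"
  using assms by (simp add: log_mean_eq_suminf)

text \<open>R is the law of the product of two independent variables. As - ln is nonnegative on the
  unit interval, log-means add even when one of them is infinite.\<close>

lemma unit_law_mult:
  assumes P: "unit_law P" and Q: "unit_law Q"
  defines "R \<equiv> distr (P \<Otimes>\<^sub>M Q) borel (\<lambda>(x, y). x * y)"
  shows "unit_law R"
    and "(\<integral>x. x ^ n \<partial>R) = (\<integral>x. x ^ n \<partial>P) * (\<integral>x. x ^ n \<partial>Q)"
    and "log_mean R = log_mean P + log_mean Q"
proof -
  interpret P: prob_space P using P by (rule unit_lawD)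
  interpret Q: prob_space Q using Q by (rule unit_lawD)
  interpret PQ: pair_prob_space P Q ..
  note [measurable_cong] = unit_lawD(2) [OF P] unit_lawD(2) [OF Q]
  have AE: "AE z in P \<Otimes>\<^sub>M Q. (0 < fst z \<and> fst z \<le> 1) \<and> (0 < snd z \<and> snd z \<le> 1)"
  proof -
    have "AE z in P \<Otimes>\<^sub>M Q. 0 < fst z \<and> fst z \<le> 1"
      by (rule PQ.AE_pair_measure) (use unit_lawD(3) [OF P] in auto)
    moreover have "AE z in P \<Otimes>\<^sub>M Q. 0 < snd z \<and> snd z \<le> 1"
      by (rule PQ.AE_pair_measure) (use unit_lawD(3) [OF Q] in auto)
    ultimately show ?thesis by eventually_elim simp
  qed
  show "unit_law R"
    unfolding unit_law_def
  proof (intro conjI)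
    show "prob_space R" unfolding R_def by (rule PQ.prob_space_distr) measurable
    show "sets R = sets borel" by (simp add: R_def)
    show "AE x in R. 0 < x \<and> x \<le> 1" unfolding R_def
      by (subst AE_distr_iff) (use AE in \<open>auto elim!: AE_mp simp: mult_le_one split: prod.split\<close>)
  qed
  show "(\<integral>x. x ^ n \<partial>R) = (\<integral>x. x ^ n \<partial>P) * (\<integral>x. x ^ n \<partial>Q)"
  proof -
    have "integrable (P \<Otimes>\<^sub>M Q) (\<lambda>(x, y). x ^ n * y ^ n)"
      by (rule PQ.integrable_const_bound [where B = 1])
         (use AE in \<open>auto elim!: AE_mp simp: abs_mult power_abs power_le_one mult_le_one split: prod.split\<close>)
    from PQ.integral_fst' [OF this]
    have "(\<integral>z. (case z of (x, y) \<Rightarrow> x ^ n * y ^ n) \<partial>(P \<Otimes>\<^sub>M Q)) = (\<integral>x. x ^ n \<partial>P) * (\<integral>x. x ^ n \<partial>Q)"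
      by simp
    then show ?thesis
      unfolding R_def by (subst integral_distr) (auto simp: power_mult_distrib split_def)
  qed
  show "log_mean R = log_mean P + log_mean Q"
  proof -
    have "log_mean R = (\<integral>\<^sup>+z. ennreal (- ln (fst z * snd z)) \<partial>(P \<Otimes>\<^sub>M Q))"
      unfolding R_def log_mean_def by (subst nn_integral_distr) (auto simp: split_def)
    also have "\<dots> = (\<integral>\<^sup>+z. ennreal (- ln (fst z)) + ennreal (- ln (snd z)) \<partial>(P \<Otimes>\<^sub>M Q))"
      by (rule nn_integral_cong_AE)
         (use AE in \<open>auto elim!: AE_mp simp: ln_mult simp flip: ennreal_plus\<close>)
    also have "\<dots> = (\<integral>\<^sup>+z. ennreal (- ln (fst z)) \<partial>(P \<Otimes>\<^sub>M Q)) + (\<integral>\<^sup>+z. ennreal (- ln (snd z)) \<partial>(P \<Otimes>\<^sub>M Q))"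
      by (rule nn_integral_add) measurable
    also have "\<dots> = log_mean P + log_mean Q"
      by (simp add: log_mean_def P.emeasure_space_1 Q.emeasure_space_1 flip: Q.nn_integral_fst)
    finally show ?thesis .
  qed
qed

text \<open>The Beta law with parameters a and d - a. Its moment of real order z is B(a + z, d - a)
  / B(a, d - a): integer z gives the Pochhammer quotient, the derivative at z = 0 gives the mean of
  ln.\<close>

lemma beta_law:
  fixes a d :: real
  assumes "0 < a" "a < d"
  shows "\<exists>P. unit_law P \<and> (\<forall>n. (\<integral>x. x ^ n \<partial>P) = pochhammer a n / pochhammer d n) \<and>
    log_mean P = ennreal (Digamma d - Digamma a)"
proof -
  let ?c = "Beta a (d - a)"
  let ?f = "\<lambda>x. indicator {0..1} x * (x powr (a - 1) * (1 - x) powr (d - a - 1)) / ?c"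
  define P where "P = density lborel ?f"
  have notin: "x \<notin> \<int>\<^sub>\<le>\<^sub>0" if "x > 0" for x :: real
    using that by (auto elim!: nonpos_Ints_cases)
  have c: "?c > 0"
    using assms by (auto simp: Beta_def intro!: divide_pos_pos mult_pos_pos Gamma_real_pos)
  have [measurable]: "?f \<in> borel_measurable lborel" by measurable
  have F: "has_bochner_integral P (\<lambda>x. x powr z) (Beta (a + z) (d - a) / ?c)" if "z \<ge> 0" for z
    unfolding P_def
  proof (rule has_bochner_integral_density)
    have "has_bochner_integral lborel (\<lambda>x. indicator {0..1} x * (x powr (a + z - 1) * (1 - x) powr (d - a - 1)))
        (Beta (a + z) (d - a))"
    proof (rule has_bochner_integral_nn_integral)
      show "(\<integral>\<^sup>+x. ennreal (indicator {0..1} x * (x powr (a + z - 1) * (1 - x) powr (d - a - 1))) \<partial>lborel) =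
          ennreal (Beta (a + z) (d - a))"
        by (rule nn_integral_has_integral_lebesgue [OF _ has_integral_Beta_real]) (use assms that in auto)
      show "0 \<le> Beta (a + z) (d - a)"
        using assms that by (auto simp: Beta_def intro!: divide_nonneg_nonneg mult_nonneg_nonneg Gamma_real_nonneg)
    qed auto
    from has_bochner_integral_divide [OF this, of ?c]
    have "has_bochner_integral lborel (\<lambda>x. indicator {0..1} x * (x powr (a + z - 1) * (1 - x) powr (d - a - 1)) / ?c)
        (Beta (a + z) (d - a) / ?c)" using c by simp
    moreover have "indicator {0..1} x * (x powr (a + z - 1) * (1 - x) powr (d - a - 1)) / ?c = ?f x *\<^sub>R x powr z" for x
    proof -
      have "x powr ((a - 1) + z) = x powr (a - 1) * x powr z"
        by (rule powr_add)
      then have "x powr (a + z - 1) = x powr (a - 1) * x powr z"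
        by (simp add: algebra_simps)
      then show ?thesis by simp
    qed
    ultimately show "has_bochner_integral lborel (\<lambda>x. ?f x *\<^sub>R x powr z) (Beta (a + z) (d - a) / ?c)"
      by simp
  qed (use c in auto)
  have unit: "AE x in P. 0 < x \<and> x \<le> 1"
    unfolding P_def using AE_lborel_singleton [of "0::real"]
    by (subst AE_density) (auto simp: indicator_def elim!: AE_mp)
  have prob: "prob_space P"
  proof
    have "has_bochner_integral P (\<lambda>x. x powr 0) 1" using F [of 0] c by simp
    then have "has_bochner_integral P (\<lambda>x. 1::real) 1"
      by (rule has_bochner_integral_cong_AE [THEN iffD1, rotated 3])
         (use unit in \<open>auto simp: P_def elim!: AE_mp\<close>)
    then have "(\<integral>\<^sup>+x. ennreal 1 \<partial>P) = ennreal 1"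
      by (subst nn_integral_eq_integral) (auto simp: has_bochner_integral_iff)
    then show "emeasure P (space P) = 1" by simp
  qed
  then interpret prob_space P .
  have law: "unit_law P"
    using prob unit by (simp add: unit_law_def) (simp add: P_def)
  have pos: "AE x in P. 0 < x" using unit by eventually_elim simp
  have moments: "(\<integral>x. x ^ n \<partial>P) = pochhammer a n / pochhammer d n" for n
  proof -
    have "(\<integral>x. x ^ n \<partial>P) = (\<integral>x. x powr real n \<partial>P)"
      by (rule integral_cong_AE)
         (use pos in \<open>auto simp: P_def powr_realpow elim!: AE_mp\<close>)
    also have "\<dots> = Beta (a + real n) (d - a) / ?c"
      using F [of "real n"] by (simp add: has_bochner_integral_iff)
    also have "\<dots> = pochhammer a n / pochhammer d n"
      using assms notin [of a] notin [of d] Gamma_real_pos [of "d - a", THEN less_imp_neq]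
      by (simp add: Beta_def pochhammer_Gamma add.commute)
    finally show ?thesis .
  qed
  have "has_bochner_integral P (\<lambda>x. ln x) (Digamma a - Digamma d)"
  proof (rule has_bochner_integral_ln [OF _ pos F])
    show "((\<lambda>z. Beta (a + z) (d - a) / ?c) has_real_derivative Digamma a - Digamma d) (at 0 within {0..})"
    proof -
      have "((\<lambda>x. Beta x (d - a)) has_field_derivative
          (Beta (a + 0) (d - a) * (Digamma (a + 0) - Digamma (a + 0 + (d - a))))) (at (a + 0))"
        by (rule has_field_derivative_Beta1) (use assms in \<open>auto intro!: notin\<close>)
      moreover have "((\<lambda>z. a + z) has_real_derivative 1) (at 0 within {0..})"
        by (auto intro!: derivative_eq_intros)
      ultimately have "((\<lambda>z. Beta (a + z) (d - a)) has_real_derivative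
          (Beta (a + 0) (d - a) * (Digamma (a + 0) - Digamma (a + 0 + (d - a)))) * 1) (at 0 within {0..})"
        by (rule DERIV_chain2)
      from DERIV_cdivide [OF this, of ?c] show ?thesis using c by simp
    qed
  qed (auto simp: P_def)
  then have "has_bochner_integral P (\<lambda>x. - ln x) (- (Digamma a - Digamma d))"
    by (rule has_bochner_integral_minus)
  then have "log_mean P = ennreal (Digamma d - Digamma a)"
    unfolding log_mean_def using unit
    by (subst nn_integral_eq_integral) (auto simp: has_bochner_integral_iff elim!: AE_mp)
  with law moments show ?thesis by blast
qed

lemma beta_product_law:
  fixes ps :: "(real \<times> real) list"
  assumes "\<forall>(x, y) \<in> set ps. 0 < x \<and> x < y"
  shows "\<exists>P. unit_law P \<and> (\<forall>n. (\<integral>x. x ^ n \<partial>P) = (\<Prod>(x, y)\<leftarrow>ps. pochhammer x n / pochhammer y n)) \<and>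
    log_mean P = ennreal (\<Sum>(x, y)\<leftarrow>ps. Digamma y - Digamma x)"
  using assms
proof (induction ps)
  case Nil
  \<comment> \<open>The empty product of independent factors is the constant 1.\<close>
  have "AE x in return borel (1::real). 0 < x \<and> x \<le> 1"
    by (subst AE_return) auto
  then have "unit_law (return borel 1)"
    by (auto simp: unit_law_def intro!: prob_space_return)
  moreover have "log_mean (return borel 1) = 0"
    unfolding log_mean_def by (subst nn_integral_return) auto
  ultimately show ?case
    by (intro exI [of _ "return borel 1"]) (auto simp: integral_return)
next
  case (Cons p ps)
  obtain x y where p: "p = (x, y)" by (cases p)
  with Cons.prems have xy: "0 < x" "x < y" by auto
  \<comment> \<open>\<open>ennreal\<close> truncates at 0 and is additive only on nonnegative
    numbers, hence the appeal to monotonicity of the digamma function.\<close>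
  have nonneg: "0 \<le> (\<Sum>(x, y)\<leftarrow>ps. Digamma y - Digamma x)"
    using Cons.prems by (intro sum_list_nonneg) (force intro!: Digamma_real_mono)
  obtain P where P: "unit_law P" "\<And>n. (\<integral>t. t ^ n \<partial>P) = pochhammer x n / pochhammer y n"
      "log_mean P = ennreal (Digamma y - Digamma x)"
    using beta_law [OF xy] by blast
  obtain Q where Q: "unit_law Q" "\<And>n. (\<integral>t. t ^ n \<partial>Q) = (\<Prod>(x, y)\<leftarrow>ps. pochhammer x n / pochhammer y n)"
      "log_mean Q = ennreal (\<Sum>(x, y)\<leftarrow>ps. Digamma y - Digamma x)"
    using Cons by auto
  show ?case
  proof (intro exI conjI allI)
    note * = unit_law_mult [OF P(1) Q(1)]
    show "unit_law (distr (P \<Otimes>\<^sub>M Q) borel (\<lambda>(x, y). x * y))" by (rule *)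
    show "(\<integral>t. t ^ n \<partial>distr (P \<Otimes>\<^sub>M Q) borel (\<lambda>(x, y). x * y)) =
        (\<Prod>(x, y)\<leftarrow>p # ps. pochhammer x n / pochhammer y n)" for n
      by (simp add: *(2) P(2) Q(2) p)
    show "log_mean (distr (P \<Otimes>\<^sub>M Q) borel (\<lambda>(x, y). x * y)) =
        ennreal (\<Sum>(x, y)\<leftarrow>p # ps. Digamma y - Digamma x)"
      using nonneg Digamma_real_mono [of x y] xy by (simp add: *(3) P(3) Q(3) p)
  qed
qed

section \<open>From Pochhammer moments to the mean of the logarithm\<close>

lemma prod_list_zip_divide:
  fixes f :: "'a \<Rightarrow> real" and g :: "'b \<Rightarrow> real"
  assumes "length as = length bs"
  shows "(\<Prod>(x, y)\<leftarrow>zip as bs. f x / g y) = (\<Prod>x\<leftarrow>as. f x) / (\<Prod>y\<leftarrow>bs. g y)"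
  using assms by (induction as bs rule: list_induct2) simp_all

lemma sum_list_zip_diff:
  fixes f :: "'a \<Rightarrow> real" and g :: "'b \<Rightarrow> real"
  assumes "length as = length bs"
  shows "(\<Sum>(x, y)\<leftarrow>zip as bs. g y - f x) = (\<Sum>y\<leftarrow>bs. g y) - (\<Sum>x\<leftarrow>as. f x)"
  using assms by (induction as bs rule: list_induct2) simp_all

text \<open>Multiplying by independent Beta factors raises every denominator parameter by \<open>N\<close>; then the
  moments are those of a product of Beta laws, and log-means are additive.\<close>

lemma has_bochner_integral_ln_of_moments:
  fixes as bs :: "real list"
  assumes P: "unit_law P" and len: "length as = length bs"
    and as: "\<forall>x\<in>set as. 0 < x" and bs: "\<forall>y\<in>set bs. 0 < y"
    and moments: "\<And>n. (\<integral>x. x ^ n \<partial>P) = (\<Prod>x\<leftarrow>as. pochhammer x n) / (\<Prod>y\<leftarrow>bs. pochhammer y n)"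
  shows "has_bochner_integral P ln ((\<Sum>x\<leftarrow>as. Digamma x) - (\<Sum>y\<leftarrow>bs. Digamma y))"
proof -
  \<comment> \<open>Once N exceeds every numerator parameter, each x in \<open>as\<close> lies below
    each y + N, so any pairing is admissible. Inserting 0 makes the maximum exist and gives N > 0,
    hence y < y + N.\<close>
  obtain N :: nat where N: "Max (insert 0 (set as)) < real N"
    using reals_Archimedean2 by blast
  then have N: "0 < real N" "\<And>x. x \<in> set as \<Longrightarrow> x < real N"
    by (auto simp: Max_less_iff)
  define cs where "cs = map (\<lambda>y. y + real N) bs"
  have cs: "length cs = length bs" "length as = length cs" by (auto simp: cs_def len)
  have pos: "(\<Prod>y\<leftarrow>bs. pochhammer y n) > 0" for n
    using bs by (induction bs) (auto simp: pochhammer_pos)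
  obtain Q where Q: "unit_law Q"
      "\<And>n. (\<integral>t. t ^ n \<partial>Q) = (\<Prod>(x, y)\<leftarrow>zip bs cs. pochhammer x n / pochhammer y n)"
      "log_mean Q = ennreal (\<Sum>(x, y)\<leftarrow>zip bs cs. Digamma y - Digamma x)"
  proof -
    have "\<forall>(x, y)\<in>set (zip bs cs). 0 < x \<and> x < y"
      using bs N by (auto simp: cs_def set_zip)
    from beta_product_law [OF this] show ?thesis using that by blast
  qed
  obtain R where R: "unit_law R"
      "\<And>n. (\<integral>t. t ^ n \<partial>R) = (\<Prod>(x, y)\<leftarrow>zip as cs. pochhammer x n / pochhammer y n)"
      "log_mean R = ennreal (\<Sum>(x, y)\<leftarrow>zip as cs. Digamma y - Digamma x)"
  proof -
    have "\<forall>(x, y)\<in>set (zip as cs). 0 < x \<and> x < y"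
    proof safe
      fix x y assume "(x, y) \<in> set (zip as cs)"
      then have "x \<in> set as" "y \<in> set cs" by (auto dest: set_zip_leftD set_zip_rightD)
      then show "0 < x" "x < y" using as bs N(2) [of x] by (auto simp: cs_def)
    qed
    from beta_product_law [OF this] show ?thesis using that by blast
  qed
  note PQ = unit_law_mult [OF P Q(1)]
  \<comment> \<open>The moments of the product of P and Q are (as / bs) (bs / cs) = as / cs, those
    of R.\<close>
  have "log_mean P + log_mean Q = log_mean R"
    unfolding PQ(3) [symmetric]
  proof (rule log_mean_cong [OF PQ(1) R(1)])
    show "(\<integral>x. x ^ n \<partial>distr (P \<Otimes>\<^sub>M Q) borel (\<lambda>(x, y). x * y)) = (\<integral>x. x ^ n \<partial>R)" for n
      using pos [of n] unfolding PQ(2) moments Q(2) R(2)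
      by (simp add: prod_list_zip_divide cs)
  qed
  moreover have "0 \<le> (\<Sum>(x, y)\<leftarrow>zip bs cs. Digamma y - Digamma x)"
    using bs N by (intro sum_list_nonneg) (auto simp: cs_def set_zip intro!: Digamma_real_mono)
  moreover have "0 \<le> (\<Sum>(x, y)\<leftarrow>zip as cs. Digamma y - Digamma x)"
  proof (intro sum_list_nonneg)
    fix t assume "t \<in> set (map (\<lambda>(x, y). Digamma y - Digamma x) (zip as cs))"
    then obtain x y where t: "t = Digamma y - Digamma x" "(x, y) \<in> set (zip as cs)" by auto
    then have "x \<in> set as" "y \<in> set cs" by (auto dest: set_zip_leftD set_zip_rightD)
    then have "0 < x" "x < y" using as bs N(2) [of x] by (auto simp: cs_def)
    then show "0 \<le> t" unfolding t using Digamma_real_mono [of x y] by simp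
  qed
  \<comment> \<open>The log-mean of R is finite, which forces that of P to be finite and allows
    subtraction; the digamma terms of \<open>cs\<close> then cancel.\<close>
  ultimately obtain r where r: "0 \<le> r" "log_mean P = ennreal r"
      "r + (\<Sum>(x, y)\<leftarrow>zip bs cs. Digamma y - Digamma x) = (\<Sum>(x, y)\<leftarrow>zip as cs. Digamma y - Digamma x)"
    unfolding Q(3) R(3) by (cases "log_mean P") (auto simp flip: ennreal_plus)
  then have r_eq: "r = (\<Sum>y\<leftarrow>bs. Digamma y) - (\<Sum>x\<leftarrow>as. Digamma x)"
    by (simp add: sum_list_zip_diff cs len)
  note [measurable_cong] = unit_lawD(2) [OF P]
  have "has_bochner_integral P (\<lambda>x. - ln x) r"
  proof (rule has_bochner_integral_nn_integral)
    show "AE x in P. 0 \<le> - ln x" using unit_lawD(3) [OF P] by eventually_elim simp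
    show "(\<integral>\<^sup>+x. ennreal (- ln x) \<partial>P) = ennreal r" using r by (simp add: log_mean_def)
  qed (use r in auto)
  from has_bochner_integral_minus [OF this] show ?thesis by (simp add: r_eq)
qed

section \<open>Even moments from the characteristic function\<close>

text \<open>Up to the factor j!, this is the coefficient of z^j in exp (n z) (1 - exp (- z))^(2n), a
  series starting with z^(2n). A central difference of order 2n thus annihilates lower
  powers.\<close>

lemma alternating_binomial_power_sum:
  fixes n :: nat
  assumes "j \<le> 2 * n"
  shows "(\<Sum>k\<le>2 * n. (- 1) ^ k * real (2 * n choose k) * (real n - real k) ^ j) =
    (if j = 2 * n then fact (2 * n) else 0)"
proof -
  \<comment> \<open>U is (1 - exp (- z)) / z, with constant coefficient 1.\<close>
  define U :: "real fps" where "U = fps_shift 1 (1 - fps_exp (- 1))"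
  have U: "1 - fps_exp (- 1) = fps_X * U"
    by (rule fps_ext) (simp add: U_def)
  have exp_power: "fps_exp (- 1 :: real) ^ k = fps_exp (- real k)" for k
    by (simp add: fps_exp_power_mult)
  have "fps_exp (real n) * (1 - fps_exp (- 1)) ^ (2 * n) =
      (\<Sum>k\<le>2 * n. fps_const ((- 1) ^ k * real (2 * n choose k)) * fps_exp (real n - real k))"
  proof -
    have "(1 - fps_exp (- 1 :: real)) ^ (2 * n) = (- fps_exp (- 1) + 1) ^ (2 * n)" by simp
    also have "\<dots> = (\<Sum>k\<le>2 * n. of_nat (2 * n choose k) * (- fps_exp (- 1)) ^ k * 1 ^ (2 * n - k))"
      by (rule binomial_ring)
    also have "fps_exp (real n) * \<dots> =
        (\<Sum>k\<le>2 * n. fps_const ((- 1) ^ k * real (2 * n choose k)) * fps_exp (real n - real k))"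
      unfolding sum_distrib_left
    proof (intro sum.cong refl)
      fix k
      have "fps_exp (real n) * (of_nat (2 * n choose k) * (- fps_exp (- 1)) ^ k * 1 ^ (2 * n - k)) =
          (- 1) ^ k * of_nat (2 * n choose k) * (fps_exp (real n) * fps_exp (- 1) ^ k)"
        by (simp add: power_minus [of "fps_exp (- 1)"] mult_ac)
      also have "fps_exp (real n) * fps_exp (- 1) ^ k = fps_exp (real n - real k)"
        by (simp add: exp_power fps_exp_add_mult [symmetric])
      also have "(- 1) ^ k * of_nat (2 * n choose k) = fps_const ((- 1) ^ k * real (2 * n choose k))"
        by (simp add: fps_of_nat [symmetric] fps_const_power [symmetric] flip: fps_const_mult fps_const_neg)
      finally show "fps_exp (real n) * (of_nat (2 * n choose k) * (- fps_exp (- 1)) ^ k * 1 ^ (2 * n - k)) =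
          fps_const ((- 1) ^ k * real (2 * n choose k)) * fps_exp (real n - real k)" .
    qed
    finally show ?thesis .
  qed
  then have "fps_nth (\<Sum>k\<le>2 * n. fps_const ((- 1) ^ k * real (2 * n choose k)) * fps_exp (real n - real k)) j =
      fps_nth (fps_X ^ (2 * n) * (fps_exp (real n) * U ^ (2 * n))) j"
    unfolding U by (simp add: power_mult_distrib mult_ac)
  also have "\<dots> = (if j = 2 * n then 1 else 0)"
    using assms by (simp add: fps_X_power_mult_nth U_def fps_nth_power_0)
  finally have "(\<Sum>k\<le>2 * n. (- 1) ^ k * real (2 * n choose k) * (real n - real k) ^ j / fact j) =
      (if j = 2 * n then 1 else 0)"
    by (simp add: fps_sum_nth)
  then show ?thesis
    by (simp add: sum_divide_distrib [symmetric] field_simps split: if_splits)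
qed

text \<open>Binomial expansion of the n-th power of 2 - 2 cos t = - e^(it) (1 - e^(-it))^2, followed
  by taking real parts. It identifies a nonnegative power with a central difference of
  cosines.\<close>

lemma two_minus_two_cos_power:
  "(2 - 2 * cos t) ^ n =
    (- 1) ^ n * (\<Sum>k\<le>2 * n. (- 1) ^ k * real (2 * n choose k) * cos ((real n - real k) * t))"
proof -
  have "complex_of_real (2 - 2 * cos t) = - (cis t * (1 - cis (- t)) ^ 2)"
  proof -
    have "cis t * cis (- t) = 1" by (simp add: cis_mult)
    then have "cis t * (1 - cis (- t)) ^ 2 = cis t + cis (- t) - 2"
      by (simp add: power2_eq_square algebra_simps) (simp add: mult.assoc [symmetric])
    also have "\<dots> = - complex_of_real (2 - 2 * cos t)" by (simp add: complex_eq_iff)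
    finally show ?thesis by simp
  qed
  then have "complex_of_real ((2 - 2 * cos t) ^ n) = (- 1) ^ n * (cis t ^ n * (1 - cis (- t)) ^ (2 * n))"
    by (simp add: power_mult power_mult_distrib power_minus [of "cis t * _"])
  also have "cis t ^ n * (1 - cis (- t)) ^ (2 * n) =
      (\<Sum>k\<le>2 * n. complex_of_real ((- 1) ^ k * real (2 * n choose k)) * cis ((real n - real k) * t))"
  proof -
    have "(1 - cis (- t)) ^ (2 * n) = (- cis (- t) + 1) ^ (2 * n)" by simp
    also have "\<dots> = (\<Sum>k\<le>2 * n. of_nat (2 * n choose k) * (- cis (- t)) ^ k * 1 ^ (2 * n - k))"
      by (rule binomial_ring)
    also have "cis t ^ n * \<dots> =
        (\<Sum>k\<le>2 * n. complex_of_real ((- 1) ^ k * real (2 * n choose k)) * cis ((real n - real k) * t))"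
      unfolding sum_distrib_left
    proof (intro sum.cong refl)
      fix k
      have "cis t ^ n * cis (- t) ^ k = cis ((real n - real k) * t)"
      proof -
        have "real n * t + real k * - t = (real n - real k) * t" by (simp add: algebra_simps)
        then show ?thesis unfolding Complex.DeMoivre cis_mult by (rule arg_cong)
      qed
      then show "cis t ^ n * (of_nat (2 * n choose k) * (- cis (- t)) ^ k * 1 ^ (2 * n - k)) =
          complex_of_real ((- 1) ^ k * real (2 * n choose k)) * cis ((real n - real k) * t)"
        by (simp add: power_minus [of "cis (- t)"] mult_ac)
    qed
    finally show ?thesis .
  qed
  finally have "complex_of_real ((2 - 2 * cos t) ^ n) = complex_of_real ((- 1) ^ n) *
      (\<Sum>k\<le>2 * n. complex_of_real ((- 1) ^ k * real (2 * n choose k)) * cis ((real n - real k) * t))"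
    by simp
  then have "Re (complex_of_real ((2 - 2 * cos t) ^ n)) = Re (complex_of_real ((- 1) ^ n) *
      (\<Sum>k\<le>2 * n. complex_of_real ((- 1) ^ k * real (2 * n choose k)) * cis ((real n - real k) * t)))"
    by (rule arg_cong)
  then show ?thesis
    by (simp only: Re_complex_of_real Im_complex_of_real times_complex.sel Re_sum cis.sel mult_zero_left diff_zero)
qed

text \<open>In this form, |sinc| <= 1 and sinc 0 = 1 give the bound and the limit of the difference
  quotients of cos.\<close>

lemma two_minus_two_cos: "2 - 2 * cos t = t\<^sup>2 * (sinc (t / 2))\<^sup>2"
proof (cases "t = 0")
  case False
  have "cos t = 1 - 2 * (sin (t / 2))\<^sup>2"
    using cos_double_sin [of "t / 2"] by simp
  then show ?thesis using False by (simp add: power_divide)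
qed simp

lemma central_difference_tendsto:
  fixes d :: "nat \<Rightarrow> real"
  assumes summable: "\<And>y. summable (\<lambda>m. d m * y ^ m)"
    and g: "\<And>s. g s = (\<Sum>m. d m * (s\<^sup>2) ^ m)"
  shows "((\<lambda>h. (\<Sum>k\<le>2 * n. (- 1) ^ k * real (2 * n choose k) * g ((real n - real k) * h)) / h ^ (2 * n))
    \<longlongrightarrow> d n * fact (2 * n)) (at 0)"
proof -
  \<comment> \<open>The coefficient of h^(2m) in the central difference of g. It vanishes for m < n
    and is d n (2n)! for m = n; the later ones contribute only positive powers of h after division
    by h^(2n).\<close>
  define e where "e m = d m * (\<Sum>k\<le>2 * n. (- 1) ^ k * real (2 * n choose k) * ((real n - real k)\<^sup>2) ^ m)" for m
  have e_less: "e m = 0" if "m < n" for m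
    using that unfolding e_def power_mult [symmetric] by (subst alternating_binomial_power_sum) auto
  have e_n: "e n = d n * fact (2 * n)"
    unfolding e_def power_mult [symmetric] by (subst alternating_binomial_power_sum) auto
  have sums: "(\<lambda>m. e m * y ^ m) sums
      (\<Sum>k\<le>2 * n. (- 1) ^ k * real (2 * n choose k) * (\<Sum>m. d m * (y * (real n - real k)\<^sup>2) ^ m))" for y
  proof -
    have "(\<lambda>m. \<Sum>k\<le>2 * n. (- 1) ^ k * real (2 * n choose k) * (d m * (y * (real n - real k)\<^sup>2) ^ m)) sums
      (\<Sum>k\<le>2 * n. (- 1) ^ k * real (2 * n choose k) * (\<Sum>m. d m * (y * (real n - real k)\<^sup>2) ^ m))"
      by (intro sums_sum sums_mult summable_sums summable)
    then show ?thesis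
      unfolding e_def by (simp add: sum_distrib_left sum_distrib_right power_mult_distrib mult_ac)
  qed
  have shift_summable: "summable (\<lambda>m. e (m + n) * y ^ m)" for y
  proof (cases "y = 0")
    case False
    have "summable (\<lambda>m. e (m + n) * y ^ (m + n))"
      using sums_summable [OF sums] by (subst summable_iff_shift [where f = "\<lambda>m. e m * y ^ m"])
    from summable_mult [OF this, of "inverse (y ^ n)"] show ?thesis
      using False by (simp add: power_add field_simps)
  qed simp
  have cont: "isCont (\<lambda>y. \<Sum>m. e (m + n) * y ^ m) 0"
    by (rule isCont_powser_converges_everywhere [OF shift_summable])
  have "((\<lambda>h::real. h\<^sup>2) \<longlongrightarrow> 0\<^sup>2) (at 0)" by (intro tendsto_intros)
  then have "((\<lambda>h. \<Sum>m. e (m + n) * (h\<^sup>2) ^ m) \<longlongrightarrow> (\<Sum>m. e (m + n) * 0 ^ m)) (at 0)"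
    by (intro isCont_tendsto_compose [OF cont]) simp
  then have lim: "((\<lambda>h. \<Sum>m. e (m + n) * (h\<^sup>2) ^ m) \<longlongrightarrow> d n * fact (2 * n)) (at 0)"
    by (simp add: powser_zero [where f = "\<lambda>m. e (m + n)"] e_n)
  show ?thesis
  proof (rule Lim_transform_eventually [OF lim])
    show "\<forall>\<^sub>F h in at 0. (\<Sum>m. e (m + n) * (h\<^sup>2) ^ m) =
        (\<Sum>k\<le>2 * n. (- 1) ^ k * real (2 * n choose k) * g ((real n - real k) * h)) / h ^ (2 * n)"
    proof (rule eventually_at_filter [THEN iffD2], intro always_eventually allI impI)
      fix h :: real assume "h \<noteq> 0"
      have "(\<lambda>m. e m * (h\<^sup>2) ^ m) sums
          (\<Sum>k\<le>2 * n. (- 1) ^ k * real (2 * n choose k) * g ((real n - real k) * h))"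
        using sums [of "h\<^sup>2"] by (simp add: g power_mult_distrib mult.commute)
      moreover have "(\<Sum>m<n. e m * (h\<^sup>2) ^ m) = 0" by (simp add: e_less)
      ultimately have "(\<lambda>m. e (m + n) * (h\<^sup>2) ^ (m + n)) sums
          (\<Sum>k\<le>2 * n. (- 1) ^ k * real (2 * n choose k) * g ((real n - real k) * h))"
        by (simp add: sums_iff_shift [where f = "\<lambda>m. e m * (h\<^sup>2) ^ m"])
      from sums_divide [OF this, of "h ^ (2 * n)"] \<open>h \<noteq> 0\<close>
      have "(\<lambda>m. e (m + n) * (h\<^sup>2) ^ m) sums
          ((\<Sum>k\<le>2 * n. (- 1) ^ k * real (2 * n choose k) * g ((real n - real k) * h)) / h ^ (2 * n))"
        by (simp add: power_add power_mult)
      then show "(\<Sum>m. e (m + n) * (h\<^sup>2) ^ m) =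
          (\<Sum>k\<le>2 * n. (- 1) ^ k * real (2 * n choose k) * g ((real n - real k) * h)) / h ^ (2 * n)"
        by (simp add: sums_iff)
    qed
  qed
qed

text \<open>Finite differences of the characteristic function rather than derivatives: \<open>2 - 2 cos (h X)\<close> is
  nonnegative, so Fatou's lemma yields the existence of the moment.\<close>

lemma (in prob_space) has_bochner_integral_even_power:
  fixes X :: "'a \<Rightarrow> real"
  assumes [measurable]: "X \<in> borel_measurable M"
    and summable: "\<And>y. summable (\<lambda>m. d m * y ^ m)"
    and g: "\<And>s. expectation (\<lambda>\<omega>. cos (s * X \<omega>)) = (\<Sum>m. d m * (s\<^sup>2) ^ m)"
  shows "has_bochner_integral M (\<lambda>\<omega>. X \<omega> ^ (2 * n)) ((- 1) ^ n * d n * fact (2 * n))"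
proof -
  define h where "h i = 1 / real (Suc i)" for i
  have h: "h i \<noteq> 0" for i by (simp add: h_def)
  have h_lim: "h \<longlonglongrightarrow> 0" unfolding h_def by (rule LIMSEQ_Suc [OF lim_1_over_n])
  \<comment> \<open>The expectation of this power is a central difference of the characteristic
    function, while pointwise it increases no further than X^(2n) and tends to it.\<close>
  let ?\<phi> = "\<lambda>i \<omega>. ((2 - 2 * cos (h i * X \<omega>)) / (h i)\<^sup>2) ^ n"
  have phi_sinc: "?\<phi> i \<omega> = X \<omega> ^ (2 * n) * (sinc (h i * X \<omega> / 2)) ^ (2 * n)" for i \<omega>
  proof -
    have "(2 - 2 * cos (h i * X \<omega>)) / (h i)\<^sup>2 = (X \<omega>)\<^sup>2 * (sinc (h i * X \<omega> / 2))\<^sup>2"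
      unfolding two_minus_two_cos power_mult_distrib using h [of i] by simp
    then show ?thesis by (simp only: power_mult_distrib power_mult)
  qed
  have sinc_le: "\<bar>sinc x\<bar> \<le> 1" for x :: real
    using abs_sin_le_one abs_sin_x_le_abs_x [of x] by (auto simp: divide_simps)
  have phi_nonneg: "0 \<le> ?\<phi> i \<omega>" for i \<omega>
    by (rule zero_le_power [OF divide_nonneg_nonneg]) auto
  have phi_le: "?\<phi> i \<omega> \<le> X \<omega> ^ (2 * n)" for i \<omega>
  proof -
    have "(sinc (h i * X \<omega> / 2)) ^ (2 * n) \<le> 1"
      unfolding power_mult by (rule power_le_one [OF zero_le_power2 abs_square_le_1 [THEN iffD2, OF sinc_le]])
    then show ?thesis
      unfolding phi_sinc by (rule mult_left_le) (simp add: power_mult)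
  qed
  have phi_lim: "(\<lambda>i. ?\<phi> i \<omega>) \<longlonglongrightarrow> X \<omega> ^ (2 * n)" for \<omega>
  proof -
    have "(\<lambda>i. h i * X \<omega> / 2) \<longlonglongrightarrow> 0 * X \<omega> / 2" by (intro tendsto_intros h_lim) auto
    then have "(\<lambda>i. sinc (h i * X \<omega> / 2)) \<longlonglongrightarrow> sinc 0"
      by (intro isCont_tendsto_compose [OF isCont_sinc]) simp
    then have "(\<lambda>i. X \<omega> ^ (2 * n) * (sinc (h i * X \<omega> / 2)) ^ (2 * n)) \<longlonglongrightarrow> X \<omega> ^ (2 * n) * (sinc 0) ^ (2 * n)"
      by (intro tendsto_intros)
    then show ?thesis unfolding phi_sinc by simp
  qed
  have "has_bochner_integral M (?\<phi> i) ((- 1) ^ n * ((\<Sum>k\<le>2 * n. (- 1) ^ k * real (2 * n choose k) *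
      expectation (\<lambda>\<omega>. cos ((real n - real k) * h i * X \<omega>))) / h i ^ (2 * n)))" for i
  proof -
    have "has_bochner_integral M (\<lambda>\<omega>. (- 1) ^ n * ((\<Sum>k\<le>2 * n. (- 1) ^ k * real (2 * n choose k) *
        cos ((real n - real k) * h i * X \<omega>)) / h i ^ (2 * n))) ((- 1) ^ n * ((\<Sum>k\<le>2 * n. (- 1) ^ k * real (2 * n choose k) *
      expectation (\<lambda>\<omega>. cos ((real n - real k) * h i * X \<omega>))) / h i ^ (2 * n)))"
      by (intro has_bochner_integral_divide has_bochner_integral_sum has_bochner_integral_mult_right
        has_bochner_integral_integrable integrable_const_bound [where B = 1]) auto
    then show ?thesis
      by (simp add: power_divide two_minus_two_cos_power power_mult mult.assoc)
  qed
  then have phi_int: "integrable M (?\<phi> i)" and phi_exp: "expectation (?\<phi> i) =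
      (- 1) ^ n * ((\<Sum>k\<le>2 * n. (- 1) ^ k * real (2 * n choose k) *
        expectation (\<lambda>\<omega>. cos ((real n - real k) * h i * X \<omega>))) / h i ^ (2 * n))" for i
    by (auto simp: has_bochner_integral_iff)
  have "(\<lambda>i. (\<Sum>k\<le>2 * n. (- 1) ^ k * real (2 * n choose k) *
        expectation (\<lambda>\<omega>. cos ((real n - real k) * h i * X \<omega>))) / h i ^ (2 * n)) \<longlonglongrightarrow> d n * fact (2 * n)"
    by (rule tendsto_compose_eventually [OF central_difference_tendsto [OF summable g] h_lim]) (simp add: h)
  then have lim: "(\<lambda>i. expectation (?\<phi> i)) \<longlonglongrightarrow> (- 1) ^ n * (d n * fact (2 * n))"
    unfolding phi_exp by (intro tendsto_intros)
  \<comment> \<open>Fatou's lemma bounds the moment by a finite limit.\<close>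
  have "(\<integral>\<^sup>+\<omega>. ennreal (X \<omega> ^ (2 * n)) \<partial>M) = (\<integral>\<^sup>+\<omega>. liminf (\<lambda>i. ennreal (?\<phi> i \<omega>)) \<partial>M)"
  proof (rule nn_integral_cong)
    fix \<omega>
    have "(\<lambda>i. ennreal (?\<phi> i \<omega>)) \<longlonglongrightarrow> ennreal (X \<omega> ^ (2 * n))"
      by (intro tendsto_ennrealI phi_lim)
    from lim_imp_Liminf [OF _ this]
    show "ennreal (X \<omega> ^ (2 * n)) = liminf (\<lambda>i. ennreal (?\<phi> i \<omega>))" by simp
  qed
  also have "\<dots> \<le> liminf (\<lambda>i. \<integral>\<^sup>+\<omega>. ennreal (?\<phi> i \<omega>) \<partial>M)"
    by (rule nn_integral_liminf) measurable
  also have "(\<lambda>i. \<integral>\<^sup>+\<omega>. ennreal (?\<phi> i \<omega>) \<partial>M) = (\<lambda>i. ennreal (expectation (?\<phi> i)))"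
    by (intro ext nn_integral_eq_integral phi_int AE_I2 phi_nonneg)
  also have "liminf \<dots> = ennreal ((- 1) ^ n * (d n * fact (2 * n)))"
    by (intro lim_imp_Liminf tendsto_ennrealI lim) simp
  finally have int: "integrable M (\<lambda>\<omega>. X \<omega> ^ (2 * n))"
    by (intro integrableI_nonneg) (auto simp: power_mult intro: le_less_trans)
  \<comment> \<open>Now that X^(2n) is known to be integrable, it serves as its own majorant and the
    bound becomes an equality.\<close>
  have "(\<lambda>i. expectation (?\<phi> i)) \<longlonglongrightarrow> expectation (\<lambda>\<omega>. X \<omega> ^ (2 * n))"
  proof (rule integral_dominated_convergence [OF _ _ int])
    show "AE \<omega> in M. norm (?\<phi> i \<omega>) \<le> X \<omega> ^ (2 * n)" for i
      using phi_le phi_nonneg by (simp only: real_norm_def abs_of_nonneg) simp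
  qed (use phi_lim in auto)
  from LIMSEQ_unique [OF this lim] int show ?thesis
    by (simp add: has_bochner_integral_iff)
qed

text \<open>For r > L the ratio test gives mu n / r^n -> 0, and Markov's inequality for Y^n bounds
  P(Y > r) by this quotient for every n. Countably many r decreasing to L suffice.\<close>

lemma (in prob_space) AE_le_of_moment_ratio:
  fixes Y :: "'a \<Rightarrow> real"
  assumes [measurable]: "Y \<in> borel_measurable M" and nonneg: "\<And>\<omega>. 0 \<le> Y \<omega>"
    and mom: "\<And>n. has_bochner_integral M (\<lambda>\<omega>. Y \<omega> ^ n) (\<mu> n)" and pos: "\<And>n. 0 < \<mu> n"
    and ratio: "(\<lambda>n. \<mu> (Suc n) / \<mu> n) \<longlonglongrightarrow> L"
  shows "AE \<omega> in M. Y \<omega> \<le> L"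
proof -
  have "L \<ge> 0"
    by (rule LIMSEQ_le_const [OF ratio]) (use pos in \<open>auto intro!: exI [of _ 0] divide_nonneg_nonneg less_imp_le\<close>)
  have step: "AE \<omega> in M. Y \<omega> \<le> r" if less: "L < r" for r
  proof -
    have "r > 0" using less \<open>L \<ge> 0\<close> by simp
    obtain c where c: "L < c" "c < r" using dense [OF less] by blast
    from order_tendstoD(2) [OF ratio c(1)] obtain N where N: "\<And>n. n \<ge> N \<Longrightarrow> \<mu> (Suc n) / \<mu> n < c"
      by (auto simp: eventually_sequentially)
    have "summable (\<lambda>n. \<mu> n / r ^ n)"
    proof (rule summable_ratio_test [of "c / r" N])
      show "c / r < 1" using c \<open>r > 0\<close> by simp
      fix n assume "N \<le> n"
      then have "\<mu> (Suc n) \<le> c * \<mu> n"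
        using N [of n] pos [of n] by (simp add: field_simps)
      then show "norm (\<mu> (Suc n) / r ^ Suc n) \<le> c / r * norm (\<mu> n / r ^ n)"
        using pos [of n] pos [of "Suc n"] \<open>r > 0\<close> by (simp add: field_simps)
    qed
    then have lim: "(\<lambda>n. \<mu> n / r ^ n) \<longlonglongrightarrow> 0" by (rule summable_LIMSEQ_zero)
    have "prob {\<omega> \<in> space M. r < Y \<omega>} \<le> \<mu> n / r ^ n" for n
    proof -
      have "prob {\<omega> \<in> space M. r < Y \<omega>} \<le> prob {\<omega> \<in> space M. r ^ n \<le> Y \<omega> ^ n}"
        by (rule finite_measure_mono) (use \<open>r > 0\<close> in \<open>auto intro!: power_mono\<close>)
      also have "\<dots> \<le> expectation (\<lambda>\<omega>. Y \<omega> ^ n) / r ^ n"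
        by (rule integral_Markov_inequality_measure [where A = "{}"])
           (use mom [of n] nonneg \<open>r > 0\<close> in \<open>auto simp: has_bochner_integral_iff\<close>)
      also have "expectation (\<lambda>\<omega>. Y \<omega> ^ n) = \<mu> n" using mom [of n] by (simp add: has_bochner_integral_iff)
      finally show ?thesis .
    qed
    then have "prob {\<omega> \<in> space M. r < Y \<omega>} \<le> 0"
      by (intro LIMSEQ_le_const [OF lim]) auto
    then have "prob {\<omega> \<in> space M. r < Y \<omega>} = 0" by (simp add: measure_le_0_iff)
    then have "AE \<omega> in M. \<not> r < Y \<omega>"
      by (subst (asm) prob_Collect_eq_0) auto
    then show ?thesis by eventually_elim simp
  qed
  have "AE \<omega> in M. \<forall>n. Y \<omega> \<le> L + 1 / real (Suc n)"
    by (subst AE_all_countable) (auto intro!: step)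
  then show ?thesis
  proof eventually_elim
    case (elim \<omega>)
    have "(\<lambda>n. L + 1 / real (Suc n)) \<longlonglongrightarrow> L + 0"
      by (intro tendsto_intros LIMSEQ_Suc [OF lim_1_over_n])
    from LIMSEQ_le_const [OF this, of "Y \<omega>"] elim show ?case by simp
  qed
qed

section \<open>Growth of Pochhammer quotients\<close>

lemma prod_list_add_over_power_tendsto:
  fixes as :: "real list"
  shows "(\<lambda>n. (\<Prod>x\<leftarrow>as. x + real n) / real n ^ length as) \<longlonglongrightarrow> 1"
proof (induction as)
  case (Cons x as)
  have "(\<lambda>n. x * (1 / real n) + 1) \<longlonglongrightarrow> x * 0 + 1"
    by (intro tendsto_intros lim_1_over_n)
  moreover have "\<forall>\<^sub>F n in sequentially. x * (1 / real n) + 1 = (x + real n) / real n"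
    using eventually_gt_at_top [of 0] by eventually_elim (simp add: field_simps)
  ultimately have "(\<lambda>n. (x + real n) / real n) \<longlonglongrightarrow> x * 0 + 1"
    by (rule Lim_transform_eventually)
  then have "(\<lambda>n. (x + real n) / real n) \<longlonglongrightarrow> 1" by simp
  from tendsto_mult [OF this Cons.IH] show ?case by simp
qed simp

text \<open>The power of 0 encodes both cases: it is 1 for equal lengths, as 0^0 = 1, and 0
  otherwise.\<close>

lemma prod_list_ratio_tendsto:
  fixes as bs :: "real list"
  assumes "length as \<le> length bs"
  shows "(\<lambda>n. (\<Prod>x\<leftarrow>as. x + real n) / (\<Prod>y\<leftarrow>bs. y + real n)) \<longlonglongrightarrow> 0 ^ (length bs - length as)"
proof -
  let ?A = "\<lambda>n. \<Prod>x\<leftarrow>as. x + real n" and ?B = "\<lambda>n. \<Prod>y\<leftarrow>bs. y + real n"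
  let ?k = "length bs - length as"
  have "(\<lambda>n. (?A n / real n ^ length as) / (?B n / real n ^ length bs) * (1 / real n) ^ ?k) \<longlonglongrightarrow> 1 / 1 * 0 ^ ?k"
    by (intro tendsto_intros prod_list_add_over_power_tendsto lim_1_over_n) auto
  moreover have "\<forall>\<^sub>F n in sequentially.
      (?A n / real n ^ length as) / (?B n / real n ^ length bs) * (1 / real n) ^ ?k = ?A n / ?B n"
    using eventually_gt_at_top [of 0]
  proof eventually_elim
    case (elim n)
    have "real n ^ length bs = real n ^ length as * real n ^ ?k"
      using assms by (simp flip: power_add)
    then show ?case using elim by (simp add: field_simps power_one_over)
  qed
  ultimately show ?thesis by (simp add: Lim_transform_eventually)
qed

lemma prod_list_pochhammer_Suc:
  fixes as :: "real list"
  shows "(\<Prod>x\<leftarrow>as. pochhammer x (Suc n)) = (\<Prod>x\<leftarrow>as. pochhammer x n) * (\<Prod>x\<leftarrow>as. x + real n)"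
  by (induction as) (simp_all add: pochhammer_Suc mult_ac)

lemma prod_list_pochhammer_pos:
  fixes as :: "real list"
  shows "\<forall>x\<in>set as. 0 < x \<Longrightarrow> (\<Prod>x\<leftarrow>as. pochhammer x n) > 0"
  by (induction as) (auto simp: pochhammer_pos)

text \<open>The factorial contributes 1 / (n + 1) to the ratio of coefficients, which therefore
  tends to 0 even when the lists have equal length.\<close>

lemma summable_hypergeo:
  fixes as bs :: "real list"
  assumes as: "\<forall>x\<in>set as. 0 < x" and bs: "\<forall>y\<in>set bs. 0 < y" and len: "length as \<le> length bs"
  shows "summable (\<lambda>n. (\<Prod>x\<leftarrow>as. pochhammer x n) / (\<Prod>y\<leftarrow>bs. pochhammer y n) / fact n * z ^ n)"
proof -
  let ?c = "\<lambda>n. (\<Prod>x\<leftarrow>as. pochhammer x n) / (\<Prod>y\<leftarrow>bs. pochhammer y n) / fact n"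
  let ?r = "\<lambda>n. (\<Prod>x\<leftarrow>as. x + real n) / (\<Prod>y\<leftarrow>bs. y + real n)"
  have pos: "?c n > 0" for n using as bs by (simp add: prod_list_pochhammer_pos)
  have Suc: "?c (Suc n) = ?c n * (?r n * (1 / real (Suc n)))" for n
    by (simp add: prod_list_pochhammer_Suc)
  have "(\<lambda>n. ?r n * (1 / real (Suc n)) * \<bar>z\<bar>) \<longlonglongrightarrow> 0 ^ (length bs - length as) * 0 * \<bar>z\<bar>"
    by (intro tendsto_intros prod_list_ratio_tendsto len LIMSEQ_Suc [OF lim_1_over_n])
  from order_tendstoD(2) [OF this, of "1 / 2"] obtain N
    where N: "\<And>n. n \<ge> N \<Longrightarrow> ?r n * (1 / real (Suc n)) * \<bar>z\<bar> < 1 / 2"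
    by (auto simp: eventually_sequentially)
  show ?thesis
  proof (rule summable_ratio_test [of "1 / 2" N])
    fix n assume "N \<le> n"
    have "?c (Suc n) * \<bar>z\<bar> ^ Suc n = (?r n * (1 / real (Suc n)) * \<bar>z\<bar>) * (?c n * \<bar>z\<bar> ^ n)"
      unfolding Suc by (simp only: power_Suc mult_ac)
    also have "\<dots> \<le> 1 / 2 * (?c n * \<bar>z\<bar> ^ n)"
      using N [OF \<open>N \<le> n\<close>]
      by (rule mult_right_mono [OF less_imp_le mult_nonneg_nonneg [OF less_imp_le [OF pos]]]) simp
    finally show "norm (?c (Suc n) * z ^ Suc n) \<le> 1 / 2 * norm (?c n * z ^ n)"
      using pos [of n] pos [of "Suc n"] by (simp only: real_norm_def abs_mult power_abs abs_of_pos)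
  qed simp
qed

section \<open>Hypergeometric characteristic functions\<close>

lemma (in prob_space) expectation_ln_abs_of_hypergeo:
  fixes X :: "'a \<Rightarrow> real" and a b :: "real list"
  assumes [measurable]: "X \<in> borel_measurable M" and nz: "AE \<omega> in M. X \<omega> \<noteq> 0"
    and a: "\<forall>x\<in>set a. 0 < x" and b: "\<forall>y\<in>set b. 0 < y" and len: "length a < length b"
    and g: "\<And>s. expectation (\<lambda>\<omega>. cos (s * X \<omega>)) = hypergeo a b (- (s\<^sup>2))"
  shows "has_bochner_integral M (\<lambda>\<omega>. ln \<bar>X \<omega>\<bar>)
    ((- euler_mascheroni + (\<Sum>x\<leftarrow>a. Digamma x) - (\<Sum>y\<leftarrow>b. Digamma y)) / 2)"
proof -
  define c where "c n = (\<Prod>x\<leftarrow>a. pochhammer x n) / (\<Prod>y\<leftarrow>b. pochhammer y n)" for n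
  define d where "d n = (- 1) ^ n * c n / fact n" for n
  \<comment> \<open>Since (2n)! = 4^n n! (1/2)_n, division by 4 leaves a pure Pochhammer quotient
    with the additional parameter 1/2.\<close>
  define Y where "Y \<omega> = (X \<omega>)\<^sup>2 / 4" for \<omega>
  have Y_meas [measurable]: "Y \<in> borel_measurable M" unfolding Y_def by measurable
  have d_eq: "d n * y ^ n = c n / fact n * (- y) ^ n" for n y
    by (simp add: d_def power_minus [of y])
  have summable: "summable (\<lambda>n. d n * y ^ n)" for y
    unfolding d_eq c_def by (rule summable_hypergeo) (use a b len in auto)
  have series: "expectation (\<lambda>\<omega>. cos (s * X \<omega>)) = (\<Sum>n. d n * (s\<^sup>2) ^ n)" for s
    unfolding g hypergeo_series d_eq by (simp add: c_def)
  define \<mu> where "\<mu> n = (\<Prod>x\<leftarrow>1 / 2 # a. pochhammer x n) / (\<Prod>y\<leftarrow>b. pochhammer y n)" for n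
  have mom: "has_bochner_integral M (\<lambda>\<omega>. Y \<omega> ^ n) (\<mu> n)" for n
  proof -
    have "(- 1) ^ n * d n * fact (2 * n) / 4 ^ n = \<mu> n"
      by (simp add: d_def c_def \<mu>_def fact_double power_mult flip: power_mult_distrib)
    moreover have "X \<omega> ^ (2 * n) / 4 ^ n = Y \<omega> ^ n" for \<omega>
      by (simp add: Y_def power_divide power_mult)
    ultimately show ?thesis
      using has_bochner_integral_divide [OF has_bochner_integral_even_power [OF assms(1) summable series], of n "4 ^ n"]
      by simp
  qed
  have pos_half: "\<forall>x\<in>set (1 / 2 # a). 0 < x" using a by simp
  have \<mu>_pos: "0 < \<mu> n" for n
    unfolding \<mu>_def by (intro divide_pos_pos prod_list_pochhammer_pos pos_half b)
  have ratio: "(\<lambda>n. \<mu> (Suc n) / \<mu> n) \<longlonglongrightarrow> 0 ^ (length b - length (1 / 2 # a))"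
  proof -
    have "\<mu> (Suc n) / \<mu> n = (\<Prod>x\<leftarrow>1 / 2 # a. x + real n) / (\<Prod>y\<leftarrow>b. y + real n)" for n
      unfolding \<mu>_def prod_list_pochhammer_Suc
      using prod_list_pochhammer_pos [OF pos_half, of n] prod_list_pochhammer_pos [OF b, of n]
      by (simp del: list.map prod_list.Cons)
    with prod_list_ratio_tendsto [of "1 / 2 # a" b] len show ?thesis
      by (simp del: list.map prod_list.Cons)
  qed
  have Y_le: "AE \<omega> in M. Y \<omega> \<le> 0 ^ (length b - length (1 / 2 # a))"
    by (rule AE_le_of_moment_ratio [OF Y_meas _ mom \<mu>_pos ratio]) (simp add: Y_def)
  have Y_pos: "AE \<omega> in M. 0 < Y \<omega>"
    using nz by eventually_elim (simp add: Y_def)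
  \<comment> \<open>With more denominator parameters the moment ratios would tend to 0, so Y <= 0
    almost surely, against X being nonzero.\<close>
  have len_eq: "length (1 / 2 # a) = length b"
  proof (rule ccontr)
    assume "length (1 / 2 # a) \<noteq> length b"
    with len have zero: "0 ^ (length b - length (1 / 2 # a)) = (0 :: real)" by simp
    have "AE \<omega> in M. Y \<omega> \<le> 0" using Y_le unfolding zero .
    with Y_pos have "AE \<omega> in M. False" by eventually_elim simp
    then show False by simp
  qed
  define P where "P = distr M borel Y"
  have P: "unit_law P"
    unfolding unit_law_def
  proof (intro conjI)
    show "prob_space P" unfolding P_def by (rule prob_space_distr) measurable
    show "sets P = sets borel" by (simp add: P_def)
    have "AE \<omega> in M. 0 < Y \<omega> \<and> Y \<omega> \<le> 1"
      using Y_pos Y_le by eventually_elim (use len_eq in simp)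
    then show "AE x in P. 0 < x \<and> x \<le> 1"
      unfolding P_def by (subst AE_distr_iff) auto
  qed
  have "has_bochner_integral P ln ((\<Sum>x\<leftarrow>1 / 2 # a. Digamma x) - (\<Sum>y\<leftarrow>b. Digamma y))"
  proof (rule has_bochner_integral_ln_of_moments [OF P len_eq pos_half b])
    show "(\<integral>x. x ^ n \<partial>P) = (\<Prod>x\<leftarrow>1 / 2 # a. pochhammer x n) / (\<Prod>y\<leftarrow>b. pochhammer y n)" for n
      using mom [of n] unfolding P_def \<mu>_def
      by (subst integral_distr) (auto simp: has_bochner_integral_iff)
  qed
  then have "has_bochner_integral M (\<lambda>\<omega>. ln (Y \<omega>)) ((\<Sum>x\<leftarrow>1 / 2 # a. Digamma x) - (\<Sum>y\<leftarrow>b. Digamma y))"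
    unfolding P_def by (simp add: has_bochner_integral_iff integrable_distr_eq integral_distr)
  then have Y_int: "has_bochner_integral M (\<lambda>\<omega>. (ln (Y \<omega>) + ln 4) / 2)
      (((\<Sum>x\<leftarrow>1 / 2 # a. Digamma x) - (\<Sum>y\<leftarrow>b. Digamma y) + ln 4) / 2)"
    by (intro has_bochner_integral_divide has_bochner_integral_add)
       (auto simp: has_bochner_integral_iff prob_space)
  \<comment> \<open>The shift by ln 4 undoes the division in Y and cancels the -2 ln 2 in
    psi(1/2).\<close>
  have "ln (4::real) = 2 * ln 2"
    using ln_realpow [of "2::real" 2] by simp
  then have val: "((\<Sum>x\<leftarrow>1 / 2 # a. Digamma x) - (\<Sum>y\<leftarrow>b. Digamma y) + ln 4) / 2 =
      (- euler_mascheroni + (\<Sum>x\<leftarrow>a. Digamma x) - (\<Sum>y\<leftarrow>b. Digamma y)) / 2"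
    using Digamma_one_half [where 'a = real] by simp
  have "AE \<omega> in M. (ln (Y \<omega>) + ln 4) / 2 = ln \<bar>X \<omega>\<bar>"
    using nz
  proof eventually_elim
    case (elim \<omega>)
    then have "ln (Y \<omega>) = ln (\<bar>X \<omega>\<bar>\<^sup>2) - ln 4"
      by (simp add: Y_def ln_div)
    then show ?case using elim ln_realpow [of "\<bar>X \<omega>\<bar>" 2] by simp
  qed
  then show ?thesis
    using Y_int unfolding val
    by (subst (asm) has_bochner_integral_cong_AE) auto
qed

lemma sum_list_eq_sum_nth: "length xs = n \<Longrightarrow> (\<Sum>x\<leftarrow>xs. f x) = (\<Sum>i<n. f (xs ! i))"
  by (auto simp: sum_list_sum_nth atLeast0LessThan)

text \<open>Existence of the improper integrals is part of the conclusion because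
  \<open>improper_integral\<close> is a \<open>Lim\<close>, which has the intended meaning only if
  the limit exists.\<close>

theorem mainTheorem1:
  fixes p q :: nat and a b :: "real list" and g :: "real \<Rightarrow> real"
    and M :: "'a measure" and X :: "'a \<Rightarrow> real" and f :: "real \<Rightarrow> real" and C :: real
  assumes "p + 1 \<le> q" and "length a = p" and "length b = q"
    and "\<forall>x\<in>set a. 0 < x" and "\<forall>y\<in>set b. 0 < y"
    and "\<forall>s. g s = hypergeo a b (- (s\<^sup>2))"
    and "prob_space M"
    and "distributed M lborel X (\<lambda>x. ennreal (f x))"
    and "\<forall>x. 0 \<le> f x" and "\<forall>x. f (- x) = f x"
    and "\<forall>s. char (distr M borel X) s = complex_of_real (g s)"
  shows "(\<forall>s>0. \<exists>L. ((\<lambda>R. integral {s..R} (\<lambda>\<xi>. g \<xi> / \<xi>)) \<longlongrightarrow> L) at_top) \<and>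
    ((shot_noise_cf C g \<longlongrightarrow> 1) (at_right 0) \<longleftrightarrow>
      C = exp (1 / 2 * (- euler_mascheroni - (\<Sum>i<p. Digamma (a ! i)) + (\<Sum>j<q. Digamma (b ! j)))))"
proof -
  interpret prob_space M by fact
  have X [measurable]: "X \<in> borel_measurable M"
    using distributed_measurable [OF assms(8)] by simp
  \<comment> \<open>The density enters here: an absolutely continuous law gives no mass to
    0.\<close>
  have nz: "AE \<omega> in M. X \<omega> \<noteq> 0"
  proof -
    have "AE x in lborel. 0 < ennreal (f x) \<longrightarrow> x \<noteq> 0"
      using AE_lborel_singleton [of "0::real"] by eventually_elim simp
    then show ?thesis by (subst distributed_AE2 [OF assms(8)]) auto
  qed
  have g_cos: "g \<xi> = expectation (\<lambda>\<omega>. cos (\<xi> * X \<omega>))" for \<xi>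
  proof -
    have "integrable M (\<lambda>\<omega>. iexp (\<xi> * X \<omega>))"
      by (rule integrable_const_bound [where B = 1]) auto
    then have "expectation (\<lambda>\<omega>. cos (\<xi> * X \<omega>)) = Re (CLINT \<omega>|M. iexp (\<xi> * X \<omega>))"
      by (subst integral_Re [symmetric]) (simp_all add: Re_exp)
    also have "(CLINT \<omega>|M. iexp (\<xi> * X \<omega>)) = char (distr M borel X) \<xi>"
      unfolding char_def by (subst integral_distr) auto
    finally show ?thesis using assms(11) by simp
  qed
  \<comment> \<open>The logarithm of the asserted constant, in the form -gamma - E ln |X|.\<close>
  define A where "A = (- euler_mascheroni - (\<Sum>i<p. Digamma (a ! i)) + (\<Sum>j<q. Digamma (b ! j))) / 2"
  have ln_int: "has_bochner_integral M (\<lambda>\<omega>. ln \<bar>X \<omega>\<bar>) (- euler_mascheroni - A)"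
    using expectation_ln_abs_of_hypergeo [OF X nz assms(4,5) _ g_cos [symmetric, unfolded assms(6) [rule_format]]] assms(1-3)
    by (simp add: A_def sum_list_eq_sum_nth field_simps)
  then have int: "integrable M (\<lambda>\<omega>. ln \<bar>X \<omega>\<bar>)" and val: "expectation (\<lambda>\<omega>. ln \<bar>X \<omega>\<bar>) = - euler_mascheroni - A"
    by (auto simp: has_bochner_integral_iff)
  have l: "\<bar>ln y + cin y - (- euler_mascheroni)\<bar> \<le> 2 / y" if "y > 0" for y
    using cosine_integral_bound [OF that] by simp
  let ?E = "\<lambda>s. expectation (\<lambda>\<omega>. cin (s * \<bar>X \<omega>\<bar>))"
  have lim: "((\<lambda>R. integral {s..R} (\<lambda>\<xi>. g \<xi> / \<xi>)) \<longlongrightarrow> A - ln s - ?E s) at_top" if "s > 0" for s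
    using improper_integral_expectation_cos [OF X nz int l g_cos that] by (simp add: val)
  \<comment> \<open>The term ln s in the exponent cancels the factor 1 / s.\<close>
  have cf: "shot_noise_cf C g s = C * exp (?E s - A)" if "s > 0" for s
  proof -
    have "improper_integral s (\<lambda>\<xi>. g \<xi> / \<xi>) = A - ln s - ?E s"
      unfolding improper_integral_def by (rule tendsto_Lim [OF _ lim [OF that]]) simp
    moreover have "- (A - ln s - ?E s) = ln s + (?E s - A)" by simp
    ultimately show ?thesis
      using that unfolding shot_noise_cf_def by (simp only: exp_add) simp
  qed
  have "((\<lambda>s. C * exp (?E s - A)) \<longlongrightarrow> C * exp (0 - A)) (at_right 0)"
    by (intro tendsto_intros expectation_cin_tendsto_0 [OF X nz int l])
  moreover have "\<forall>\<^sub>F s in at_right 0. C * exp (?E s - A) = shot_noise_cf C g s"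
    using eventually_at_right_less [of 0] by eventually_elim (simp add: cf)
  ultimately have cf_lim: "(shot_noise_cf C g \<longlongrightarrow> C * exp (0 - A)) (at_right 0)"
    by (rule Lim_transform_eventually)
  \<comment> \<open>The limit exists for every C, so uniqueness of limits turns the normalization
    into an equation for C.\<close>
  have "(shot_noise_cf C g \<longlongrightarrow> 1) (at_right 0) \<longleftrightarrow> C * exp (0 - A) = 1"
    using cf_lim tendsto_unique [OF _ cf_lim] by (metis trivial_limit_at_right_real)
  also have "\<dots> \<longleftrightarrow> C = exp A"
    by (auto simp: exp_minus field_simps)
  finally show ?thesis
    using lim by (auto simp: A_def)
qed

end
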